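(* Let $V$ be a valuation domain with quotient field $K$ whose maximal ideal $M$ is not finitely generated and whose residue field $k=V/M$ is infinite. Let $\alpha\in K$, $c\in K\setminus\{0\}$, $\delta=v(c)$. Let $E\subset K$ be a pseudo-convergent sequence and $F\subset K$ a pseudo-stationary sequence with $\mathcal L_E=\mathcal L_F=\alpha+cV$ and, for every $z\in\alpha+cV$, let $D_z\subset K$ be a pseudo-divergent sequence with $\mathcal L_{D_z}=z+cM$. Let $M_F$ be the maximal ideal of $V_F$, $\pi:V_F\to V_F/M_F$ the quotient map and $t=\pi\left(\frac{X-\alpha}{c}\right)$, so that $V_F/M_F=k(t)$ with $t$ transcendental over $k$. Then: (a) $\pi(V_E)=k[1/t]_{(1/t)}$; (b) for every $z\in\alpha+cV$, $\pi(V_{D_z})=k[t]_{(t-\theta(z))}$, where $\theta(z)=\pi\left(\frac{z-\alpha}{c}\right)\in k$; (c) for every $x\in k$, $\pi^{-1}(k[t]_{(t-x)})=V_{D_{\alpha+yc}}$, where $y$ is an element of $V$ satisfying $\pi(y)=x$.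
   Context: $v$ denotes the valuation of $V$ and $\Gamma_v$ its value group. Sequences $E=\{s_\nu\}_{\nu\in\Lambda}\subset K$ are indexed by well-ordered sets $\Lambda$ without maximum. $E$ is pseudo-convergent if $v(s_\rho-s_\nu)<v(s_\sigma-s_\rho)$ for all $\nu<\rho<\sigma$; pseudo-divergent if $v(s_\rho-s_\nu)>v(s_\sigma-s_\rho)$ for all $\nu<\rho<\sigma$; pseudo-stationary if $v(s_\nu-s_\mu)=v(s_{\nu'}-s_{\mu'})$ for all $\nu\ne\mu$, $\nu'\neq\mu'$; pseudo-monotone if it is one of these three. The gauge $\{\delta_\nu\}$ of $E$ is: $\delta_\nu=v(s_\rho-s_\nu)$ for any $\rho>\nu$ if $E$ is pseudo-convergent; $\delta_\nu=v(s_\rho-s_\nu)$ for any $\rho<\nu$ ($\nu$ not the minimum of $\Lambda$) if $E$ is pseudo-divergent; the constant $\delta_\nu=v(s_\rho-s_\mu)$, $\rho\neq\mu$, if $E$ is pseudo-stationary. An element $\alpha\in K$ is a pseudo-limit of $E$ if $v(\alpha-s_\nu)=\delta_\nu$ for all sufficiently large $\nu$; $\mathcal L_E$ is the set of pseudo-limits of $E$ in $K$. For a pseudo-monotone $E$, $V_E=\{\phi\in K(X)\mid \phi(s_\nu)\in V\text{ for all sufficiently large }\nu\in\Lambda\}$, a valuation domain of $K(X)$ extending $V$. In the setting of the statement, $V_E$ and all $V_{D_z}$ are contained in $V_F$ and contain $M_F$, and $\pi$ restricted to $V$ is the residue map $V\to k\subset k(t)$. *)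

theory Defs
  imports
    "HOL-Algebra.Algebraic_Closure_Type"
    "HOL-Algebra.Generated_Fields"
    "HOL-Algebra.Finite_Extensions"
    "HOL-Computational_Algebra.Polynomial_Factorial"
begin

text \<open>
  The ambient fields \<open>K\<close> and \<open>K(X)\<close> are the types \<open>'a::field\<close> and \<open>'a poly fract\<close>. Subrings of
  them are sets, and they become HOL-Algebra rings by restricting the carrier of
  \<^const>\<open>ring_of_type_algebra\<close>, so that ideals and quotients are those of the library.
\<close>

abbreviation ring_on :: "'f::comm_ring_1 set \<Rightarrow> 'f ring"
  where "ring_on A \<equiv> ring_of_type_algebra\<lparr>carrier := A\<rparr>"

text \<open>
  The second condition forces \<open>K\<close> to be the quotient field of \<open>V\<close>, as \<open>x = x / 1\<close> or
  \<open>x = 1 / inverse x\<close>. Fields are not excluded.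
\<close>

definition valuation_domain_of :: "'a::field set \<Rightarrow> bool"
  where "valuation_domain_of V \<longleftrightarrow>
    subring V ring_of_type_algebra \<and> (\<forall>x. x \<noteq> 0 \<longrightarrow> x \<in> V \<or> inverse x \<in> V)"

definition fg_ideal :: "('f, 'm) ring_scheme \<Rightarrow> 'f set \<Rightarrow> bool"
  where "fg_ideal R I \<longleftrightarrow> (\<exists>S. finite S \<and> S \<subseteq> carrier R \<and> I = Idl\<^bsub>R\<^esub> S)"


section \<open>The valuation\<close>

text \<open>
  The value group of \<open>V\<close> is \<open>K\<^sup>* / V\<^sup>*\<close>, ordered by \<open>v x \<le> v y\<close> iff \<open>y / x \<in> V\<close>. We realise
  \<open>v x\<close> as the principal fractional ideal \<open>xV\<close>, which is the class of \<open>x\<close> modulo \<open>V\<^sup>*\<close>;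
  the order of the value group is then reverse inclusion, and \<open>v 0 = {0}\<close> is the value
  \<open>\<infinity>\<close>, lying above all others.
\<close>

definition val :: "'a::field set \<Rightarrow> 'a \<Rightarrow> 'a set"
  where "val V x = (\<lambda>w. x * w) ` V"

definition val_less :: "'a set \<Rightarrow> 'a set \<Rightarrow> bool"  (infix \<open>\<prec>\<close> 50)
  where "\<gamma> \<prec> \<gamma>' \<longleftrightarrow> \<gamma>' \<subset> \<gamma>"


section \<open>Pseudo-monotone sequences\<close>

text \<open>
  A sequence is a function \<open>s\<close> restricted to an index set \<open>\<Lambda>\<close> inside a well-ordered type. Letting
  \<open>\<Lambda>\<close> be a subset allows the members of a family of sequences to have index sets of
  different order types.
\<close>

definition index_set :: "'i::wellorder set \<Rightarrow> bool"
  where "index_set \<Lambda> \<longleftrightarrow> \<Lambda> \<noteq> {} \<and> (\<forall>\<nu>\<in>\<Lambda>. \<exists>\<rho>\<in>\<Lambda>. \<nu> < \<rho>)"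

definition for_large :: "'i::wellorder set \<Rightarrow> ('i \<Rightarrow> bool) \<Rightarrow> bool"
  where "for_large \<Lambda> P \<longleftrightarrow> (\<exists>N\<in>\<Lambda>. \<forall>\<nu>\<in>\<Lambda>. N \<le> \<nu> \<longrightarrow> P \<nu>)"

definition pseudo_convergent :: "'a::field set \<Rightarrow> 'i::wellorder set \<Rightarrow> ('i \<Rightarrow> 'a) \<Rightarrow> bool"
  where "pseudo_convergent V \<Lambda> s \<longleftrightarrow> index_set \<Lambda> \<and>
    (\<forall>\<nu>\<in>\<Lambda>. \<forall>\<rho>\<in>\<Lambda>. \<forall>\<sigma>\<in>\<Lambda>. \<nu> < \<rho> \<longrightarrow> \<rho> < \<sigma> \<longrightarrow> val V (s \<rho> - s \<nu>) \<prec> val V (s \<sigma> - s \<rho>))"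

definition pseudo_divergent :: "'a::field set \<Rightarrow> 'i::wellorder set \<Rightarrow> ('i \<Rightarrow> 'a) \<Rightarrow> bool"
  where "pseudo_divergent V \<Lambda> s \<longleftrightarrow> index_set \<Lambda> \<and>
    (\<forall>\<nu>\<in>\<Lambda>. \<forall>\<rho>\<in>\<Lambda>. \<forall>\<sigma>\<in>\<Lambda>. \<nu> < \<rho> \<longrightarrow> \<rho> < \<sigma> \<longrightarrow> val V (s \<sigma> - s \<rho>) \<prec> val V (s \<rho> - s \<nu>))"

definition pseudo_stationary :: "'a::field set \<Rightarrow> 'i::wellorder set \<Rightarrow> ('i \<Rightarrow> 'a) \<Rightarrow> bool"
  where "pseudo_stationary V \<Lambda> s \<longleftrightarrow> index_set \<Lambda> \<and>
    (\<forall>\<nu>\<in>\<Lambda>. \<forall>\<mu>\<in>\<Lambda>. \<forall>\<nu>'\<in>\<Lambda>. \<forall>\<mu>'\<in>\<Lambda>. \<nu> \<noteq> \<mu> \<longrightarrow> \<nu>' \<noteq> \<mu>' \<longrightarrow>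
      val V (s \<nu> - s \<mu>) = val V (s \<nu>' - s \<mu>'))"

text \<open>
  For a pseudo-divergent sequence the gauge is left free at the minimum of \<open>\<Lambda>\<close> (and outside
  \<open>\<Lambda>\<close>), where it plays no role. By the ultrametric inequality every pseudo-monotone sequence over a
  valuation domain has a gauge.
\<close>

definition is_gauge :: "'a::field set \<Rightarrow> 'i::wellorder set \<Rightarrow> ('i \<Rightarrow> 'a) \<Rightarrow> ('i \<Rightarrow> 'a set) \<Rightarrow> bool"
  where "is_gauge V \<Lambda> s \<delta> \<longleftrightarrow>
    pseudo_convergent V \<Lambda> s \<and> (\<forall>\<nu>\<in>\<Lambda>. \<forall>\<rho>\<in>\<Lambda>. \<nu> < \<rho> \<longrightarrow> \<delta> \<nu> = val V (s \<rho> - s \<nu>)) \<or>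
    pseudo_divergent V \<Lambda> s \<and> (\<forall>\<nu>\<in>\<Lambda>. \<forall>\<rho>\<in>\<Lambda>. \<rho> < \<nu> \<longrightarrow> \<delta> \<nu> = val V (s \<rho> - s \<nu>)) \<or>
    pseudo_stationary V \<Lambda> s \<and>
      (\<forall>\<nu>\<in>\<Lambda>. \<forall>\<rho>\<in>\<Lambda>. \<forall>\<mu>\<in>\<Lambda>. \<rho> \<noteq> \<mu> \<longrightarrow> \<delta> \<nu> = val V (s \<rho> - s \<mu>))"

definition pseudo_limits :: "'a::field set \<Rightarrow> 'i::wellorder set \<Rightarrow> ('i \<Rightarrow> 'a) \<Rightarrow> 'a set"
  where "pseudo_limits V \<Lambda> s =
    {\<alpha>. \<exists>\<delta>. is_gauge V \<Lambda> s \<delta> \<and> for_large \<Lambda> (\<lambda>\<nu>. val V (\<alpha> - s \<nu>) = \<delta> \<nu>)}"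


section \<open>Rational functions and the rings \<open>V\<^sub>E\<close>\<close>

abbreviation const_fun :: "'a::field \<Rightarrow> 'a poly fract"
  where "const_fun a \<equiv> to_fract [:a:]"

abbreviation var_X :: "'a::field poly fract"
  where "var_X \<equiv> to_fract [:0, 1:]"

text \<open>
  \<open>ratfun_value \<phi> a b\<close>: the rational function \<open>\<phi>\<close> has no pole at \<open>a\<close> and \<open>\<phi>(a) = b\<close>. The value
  does not depend on the representing fraction \<open>p / q\<close> with \<open>q(a) \<noteq> 0\<close>.
\<close>

definition ratfun_value :: "'a::field poly fract \<Rightarrow> 'a \<Rightarrow> 'a \<Rightarrow> bool"
  where "ratfun_value \<phi> a b \<longleftrightarrow>
    (\<exists>p q. \<phi> = Fract p q \<and> poly q a \<noteq> 0 \<and> b = poly p a / poly q a)"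

definition seq_domain :: "'a::field set \<Rightarrow> 'i::wellorder set \<Rightarrow> ('i \<Rightarrow> 'a) \<Rightarrow> 'a poly fract set"
  where "seq_domain V \<Lambda> s = {\<phi>. for_large \<Lambda> (\<lambda>\<nu>. \<exists>b\<in>V. ratfun_value \<phi> (s \<nu>) b)}"


section \<open>Localizations inside a field\<close>

text \<open>
  \<open>localize_at L A P\<close> is the localization \<open>A\<^sub>P\<close> of a subring \<open>A\<close> of a field \<open>L\<close> at a prime
  ideal \<open>P\<close> of \<open>A\<close>, as a subset of \<open>L\<close>.
\<close>

definition localize_at :: "('f, 'm) ring_scheme \<Rightarrow> 'f set \<Rightarrow> 'f set \<Rightarrow> 'f set"
  where "localize_at L A P = {a \<otimes>\<^bsub>L\<^esub> inv\<^bsub>L\<^esub> b | a b. a \<in> A \<and> b \<in> A - P}"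

text \<open>
  \<open>poly_local L k u w\<close> is \<open>k[u]\<^bsub>(w)\<^esub>\<close>, for a subfield \<open>k\<close> of \<open>L\<close>, \<open>u \<in> L\<close> and \<open>w \<in> k[u]\<close>.
\<close>

definition poly_local :: "('f, 'm) ring_scheme \<Rightarrow> 'f set \<Rightarrow> 'f \<Rightarrow> 'f \<Rightarrow> 'f set"
  where "poly_local L k u w =
    (let A = ring.simple_extension L k u
     in localize_at L A (PIdl\<^bsub>L\<lparr>carrier := A\<rparr>\<^esub> w))"

end

theory Submission
  imports Defs
begin

text \<open>
  Write \<open>T\<^sub>z = (X - z) / c\<close>. Along \<open>F\<close> the values of \<open>T\<^sub>z\<close> (\<open>z \<in> \<alpha> + cV\<close>) and of \<open>1 / T\<^sub>\<alpha>\<close> lie in \<open>V\<close> and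
  eventually leave every residue class modulo \<open>M\<close>; as a nonzero polynomial over \<open>V/M\<close> has
  finitely many roots, \<open>V\<^sub>F\<close> is the Gauss extension of \<open>V\<close> with respect to each such parameter \<open>U\<close>:
  it consists of the fractions \<open>p(U) / q(U)\<close> with \<open>p, q \<in> V[U]\<close>, \<open>q \<notin> M[U]\<close>, and \<open>M\<^sub>F\<close> of those
  with \<open>p \<in> M[U]\<close>.

  Along \<open>D\<^sub>z\<close> the values \<open>r\<close> of \<open>U = T\<^sub>z\<close>, and along \<open>E\<close> those of \<open>U = 1 / T\<^sub>\<alpha>\<close>, lie in \<open>M\<close>, and
  every nonzero element of \<open>M\<close> is eventually divisible by each fixed power of \<open>r\<close>. Hence
  \<open>p(r)\<close> is a unit times \<open>r\<^sup>d\<close>, where \<open>d\<close> is the order at \<open>0\<close> of the reduction of \<open>p \<in> V[U] - M[U]\<close>,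
  while \<open>p(r) \<in> r\<^sup>nM\<close> for all \<open>n\<close> if \<open>p \<in> M[U]\<close>. So the domain of the sequence
  is the preimage in \<open>V\<^sub>F\<close> of the localization of \<open>k[\<pi>(U)]\<close> at \<open>\<pi>(U)\<close>, which gives all three claims.
\<close>

section \<open>Valuation domains and their residue fields\<close>

lemma ring_of_type_algebra_sel:
  "carrier ring_of_type_algebra = UNIV"
  "x \<otimes>\<^bsub>ring_of_type_algebra\<^esub> y = x * y" "x \<oplus>\<^bsub>ring_of_type_algebra\<^esub> y = x + y"
  "\<one>\<^bsub>ring_of_type_algebra\<^esub> = 1" "\<zero>\<^bsub>ring_of_type_algebra\<^esub> = 0"
  for x y :: "'f::comm_ring_1"
  by (simp_all add: ring_of_type_algebra_def)

lemma a_inv_ring_of_type_algebra: "\<ominus>\<^bsub>ring_of_type_algebra\<^esub> x = - x"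
  for x :: "'f::comm_ring_1"
proof -
  interpret R: ring "ring_of_type_algebra :: 'f ring" by rule
  show ?thesis by (rule R.minus_equality) (simp_all add: ring_of_type_algebra_sel)
qed

text \<open>The locale serves twice: for \<open>V\<close> and its maximal ideal inside K, and for
  the domain of the stationary sequence and \<open>MF\<close> inside K(X).\<close>

locale valuation_max =
  fixes A I :: "'f::field set"
  assumes valuation_domain: "valuation_domain_of A"
    and maximal: "maximalideal I (ring_on A)"
begin

lemma subring_A: "subring A ring_of_type_algebra"
  using valuation_domain by (simp add: valuation_domain_of_def)

lemma zero_closed [simp, intro]: "0 \<in> A"
  using subringE(2)[OF subring_A] by (simp add: ring_of_type_algebra_sel)

lemma one_closed [simp, intro]: "1 \<in> A"
  using subringE(3)[OF subring_A] by (simp add: ring_of_type_algebra_sel)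

lemma add_closed [simp, intro]: "x \<in> A \<Longrightarrow> y \<in> A \<Longrightarrow> x + y \<in> A"
  using subringE(7)[OF subring_A] by (simp add: ring_of_type_algebra_sel)

lemma mult_closed [simp, intro]: "x \<in> A \<Longrightarrow> y \<in> A \<Longrightarrow> x * y \<in> A"
  using subringE(6)[OF subring_A] by (simp add: ring_of_type_algebra_sel)

lemma uminus_closed [simp, intro]: "x \<in> A \<Longrightarrow> - x \<in> A"
  using subringE(5)[OF subring_A] by (simp add: a_inv_ring_of_type_algebra)

lemma diff_closed [simp, intro]: "x \<in> A \<Longrightarrow> y \<in> A \<Longrightarrow> x - y \<in> A"
  using add_closed[of x "- y"] by simp

lemma power_closed [simp, intro]: "x \<in> A \<Longrightarrow> x ^ n \<in> A"
  by (induction n) auto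

lemma inverse_closed: "x \<notin> A \<Longrightarrow> inverse x \<in> A"
  using valuation_domain by (cases "x = 0") (auto simp: valuation_domain_of_def)

lemma cring_on: "cring (ring_on A)"
proof -
  interpret R: cring "ring_of_type_algebra :: 'f ring" by rule
  interpret S: ring "ring_on A" using R.subring_is_ring[OF subring_A] .
  show ?thesis by unfold_locales (simp add: ring_of_type_algebra_sel mult.commute)
qed

lemma I_subset: "x \<in> I \<Longrightarrow> x \<in> A"
proof -
  interpret maximalideal I "ring_on A" by (rule maximal)
  show "x \<in> I \<Longrightarrow> x \<in> A" using a_Hcarr[of x] by (simp add: ring_of_type_algebra_sel)
qed

lemma I_zero [simp]: "0 \<in> I"
proof -
  interpret maximalideal I "ring_on A" by (rule maximal)
  show ?thesis using additive_subgroup.zero_closed[OF is_additive_subgroup] by (simp add: ring_of_type_algebra_sel)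
qed

lemma I_add: "x \<in> I \<Longrightarrow> y \<in> I \<Longrightarrow> x + y \<in> I"
proof -
  interpret maximalideal I "ring_on A" by (rule maximal)
  show "x \<in> I \<Longrightarrow> y \<in> I \<Longrightarrow> x + y \<in> I" using additive_subgroup.a_closed[OF is_additive_subgroup, of x y] by (simp add: ring_of_type_algebra_sel)
qed

lemma I_mult: "x \<in> I \<Longrightarrow> y \<in> A \<Longrightarrow> x * y \<in> I"
proof -
  interpret maximalideal I "ring_on A" by (rule maximal)
  show "x \<in> I \<Longrightarrow> y \<in> A \<Longrightarrow> x * y \<in> I" using I_r_closed[of x y] by (simp add: ring_of_type_algebra_sel)
qed

lemma I_mult': "y \<in> A \<Longrightarrow> x \<in> I \<Longrightarrow> y * x \<in> I"
  using I_mult[of x y] by (simp add: mult.commute)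

lemma I_uminus: "x \<in> I \<Longrightarrow> - x \<in> I"
  using I_mult[of x "-1"] by simp

lemma I_diff: "x \<in> I \<Longrightarrow> y \<in> I \<Longrightarrow> x - y \<in> I"
  using I_add[of x "- y"] I_uminus by simp

lemma I_power: "x \<in> I \<Longrightarrow> 0 < n \<Longrightarrow> x ^ n \<in> I"
  by (cases n) (simp_all add: I_mult I_subset)

lemma one_notin_I: "1 \<notin> I"
proof
  assume "1 \<in> I"
  then have "A \<subseteq> I" using I_mult[of 1] by auto
  then show False
    using maximalideal.I_notcarr[OF maximal] I_subset by (auto simp: ring_of_type_algebra_sel)
qed

definition res :: "'f \<Rightarrow> 'f set"
  where "res x = I +>\<^bsub>ring_on A\<^esub> x"

abbreviation L :: "'f set ring"
  where "L \<equiv> ring_on A Quot I"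

lemma field_L: "field L"
  using maximalideal.quotient_is_field[OF maximal cring_on] .

sublocale L: field L
  by (rule field_L)

lemma res_hom: "res \<in> ring_hom (ring_on A) L"
proof -
  interpret maximalideal I "ring_on A" by (rule maximal)
  show ?thesis using rcos_ring_hom by (simp add: res_def [abs_def])
qed

lemma carrier_L: "carrier L = res ` A"
  by (auto simp: FactRing_def A_RCOSETS_def' res_def ring_of_type_algebra_sel)

lemma res_closed [simp, intro]: "x \<in> A \<Longrightarrow> res x \<in> carrier L"
  by (simp add: carrier_L)

lemma res_add: "x \<in> A \<Longrightarrow> y \<in> A \<Longrightarrow> res (x + y) = res x \<oplus>\<^bsub>L\<^esub> res y"
  using ring_hom_add[OF res_hom, of x y] by (simp add: ring_of_type_algebra_sel)

lemma res_mult: "x \<in> A \<Longrightarrow> y \<in> A \<Longrightarrow> res (x * y) = res x \<otimes>\<^bsub>L\<^esub> res y"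
  using ring_hom_mult[OF res_hom, of x y] by (simp add: ring_of_type_algebra_sel)

lemma res_one: "res 1 = \<one>\<^bsub>L\<^esub>"
  using ring_hom_one[OF res_hom] by (simp add: ring_of_type_algebra_sel)

lemma res_zero: "res 0 = \<zero>\<^bsub>L\<^esub>"
  using ring_hom_zero[OF res_hom cring.axioms(1)[OF cring_on] L.ring_axioms] by (simp add: ring_of_type_algebra_sel)

lemma res_uminus: "x \<in> A \<Longrightarrow> res (- x) = \<ominus>\<^bsub>L\<^esub> res x"
  using res_add[of "- x" x] by (simp add: res_zero L.minus_equality)

lemma res_diff: "x \<in> A \<Longrightarrow> y \<in> A \<Longrightarrow> res (x - y) = res x \<ominus>\<^bsub>L\<^esub> res y"
  using res_add[of x "- y"] by (simp add: res_uminus L.minus_eq)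

lemma res_eq_zero_iff: "x \<in> A \<Longrightarrow> res x = \<zero>\<^bsub>L\<^esub> \<longleftrightarrow> x \<in> I"
proof -
  assume x: "x \<in> A"
  interpret maximalideal I "ring_on A" by (rule maximal)
  have "res x = I \<longleftrightarrow> x \<in> I"
    using a_rcos_const[of x] a_rcos_self[of x] x by (auto simp: res_def ring_of_type_algebra_sel)
  then show ?thesis by (simp add: FactRing_def)
qed

lemma res_eq_iff: "x \<in> A \<Longrightarrow> y \<in> A \<Longrightarrow> res x = res y \<longleftrightarrow> x - y \<in> I"
  by (simp flip: res_eq_zero_iff add: res_diff L.r_right_minus_eq)

lemma I_prime: "x \<in> A \<Longrightarrow> y \<in> A \<Longrightarrow> x * y \<in> I \<Longrightarrow> x \<in> I \<or> y \<in> I"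
  using L.integral[of "res x" "res y"] by (auto simp flip: res_eq_zero_iff simp: res_mult)

text \<open>Comparability does the work: 1 / (1 + e) = 1 - e / (1 + e), and if e / (1 + e) were not
  in \<open>A\<close>, then (1 + e) / e would be, and multiplying it by e would put 1 + e into
  \<open>I\<close>.\<close>

lemma inverse_one_plus_I:
  assumes e: "e \<in> I" shows "inverse (1 + e) \<in> A"
proof -
  have u: "1 + e \<notin> I" using I_diff[OF _ e, of "1 + e"] one_notin_I by auto
  then have u0: "1 + e \<noteq> 0" by (metis I_zero)
  have "e / (1 + e) \<in> A"
  proof (rule ccontr)
    assume n: "e / (1 + e) \<notin> A"
    then have "(1 + e) / e \<in> A" "e \<noteq> 0" using inverse_closed[of "e / (1 + e)"] by auto
    then have "(1 + e) / e * e \<in> I" using e I_mult' by blast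
    then show False using u \<open>e \<noteq> 0\<close> by simp
  qed
  then have "1 - e / (1 + e) \<in> A" by blast
  then show ?thesis using u0 by (simp add: field_simps)
qed

text \<open>Maximality enters through the field \<open>L\<close>: if 1 / x were outside
  \<open>I\<close>, it would have an inverse w modulo \<open>I\<close>, so w / x = 1 + e with e in
  \<open>I\<close>, and x = w / (1 + e) would lie in \<open>A\<close>.\<close>

lemma inverse_in_I:
  assumes x: "x \<notin> A" shows "inverse x \<in> I"
proof (rule ccontr)
  assume n: "inverse x \<notin> I"
  have y: "inverse x \<in> A" using inverse_closed[OF x] .
  have "res (inverse x) \<in> Units L"
    using n y by (simp add: L.field_Units res_eq_zero_iff)
  then obtain b where "b \<in> carrier L" "res (inverse x) \<otimes>\<^bsub>L\<^esub> b = \<one>\<^bsub>L\<^esub>"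
    using L.Units_r_inv by blast
  then obtain w where w: "w \<in> A" and "res (inverse x) \<otimes>\<^bsub>L\<^esub> res w = \<one>\<^bsub>L\<^esub>"
    unfolding carrier_L by blast
  then have "res (inverse x * w) = res 1" using y by (simp add: res_mult res_one)
  then have i: "inverse x * w - 1 \<in> I" using y w by (simp add: res_eq_iff)
  have x0: "x \<noteq> 0" using x by auto
  have w0: "w \<noteq> 0" using i one_notin_I I_uminus[OF i] by auto
  have "w * inverse (1 + (inverse x * w - 1)) \<in> A"
    using w inverse_one_plus_I[OF i] by blast
  then show False using x x0 w0 by (simp add: field_simps)
qed

lemma inverse_notin_I_closed: "x \<in> A \<Longrightarrow> x \<notin> I \<Longrightarrow> inverse x \<in> A"
  using inverse_in_I[of "inverse x"] inverse_inverse_eq[of x] by auto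

lemma I_nonunit: "x \<in> I \<Longrightarrow> inverse x \<in> A \<Longrightarrow> x = 0"
  using I_mult[of x "inverse x"] one_notin_I by (cases "x = 0") auto

text \<open>The maximal ideal is the set of non-units, so membership in an abstractly given maximal
  ideal can be tested by inverses alone.\<close>

lemma I_iff: "x \<in> I \<longleftrightarrow> x = 0 \<or> inverse x \<notin> A"
  using I_nonunit[of x] inverse_in_I[of "inverse x"] by auto

lemma divide_closed: "x \<in> A \<Longrightarrow> y \<in> A \<Longrightarrow> y \<notin> I \<Longrightarrow> x / y \<in> A"
  using inverse_notin_I_closed by (simp add: divide_inverse)

lemma divide_in_I: "x \<in> I \<Longrightarrow> y \<in> A \<Longrightarrow> y \<notin> I \<Longrightarrow> x / y \<in> I"
  using inverse_notin_I_closed by (simp add: divide_inverse I_mult)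

lemma res_power: "x \<in> A \<Longrightarrow> res (x ^ n) = res x [^]\<^bsub>L\<^esub> n"
  by (induction n) (simp_all add: res_one res_mult L.m_comm)

lemma res_inverse:
  assumes "x \<in> A" "x \<notin> I"
  shows "res (inverse x) = inv\<^bsub>L\<^esub> res x"
proof -
  have x: "inverse x \<in> A" "x \<noteq> 0" using assms inverse_notin_I_closed by auto
  then have "res x \<otimes>\<^bsub>L\<^esub> res (inverse x) = \<one>\<^bsub>L\<^esub>"
    using assms by (simp flip: res_mult add: res_one)
  then have "inv\<^bsub>L\<^esub> res x = res (inverse x)"
    using assms x by (intro L.inv_char) (auto simp: L.m_comm)
  then show ?thesis by simp
qed

lemma res_divide:
  "x \<in> A \<Longrightarrow> y \<in> A \<Longrightarrow> y \<notin> I \<Longrightarrow> res (x / y) = res x \<otimes>\<^bsub>L\<^esub> inv\<^bsub>L\<^esub> res y"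
  by (simp add: divide_inverse res_mult res_inverse inverse_notin_I_closed)

section \<open>The order of the value group\<close>

lemma val_subset_iff: "val A y \<subseteq> val A x \<longleftrightarrow> y \<in> (*) x ` A"
proof
  assume "val A y \<subseteq> val A x"
  moreover have "y \<in> val A y" by (auto simp: val_def intro!: image_eqI[where x = 1])
  ultimately show "y \<in> (*) x ` A" by (auto simp: val_def)
next
  assume "y \<in> (*) x ` A"
  then obtain w where "w \<in> A" "y = x * w" by auto
  then show "val A y \<subseteq> val A x" by (auto simp: val_def mult.assoc)
qed

lemma val_subset_iff': "val A y \<subseteq> val A x \<longleftrightarrow> (if x = 0 then y = 0 else y / x \<in> A)"
proof -
  have "y = x * (y / x)" if "x \<noteq> 0" using that by simp
  then show ?thesis
    unfolding val_subset_iff by (auto intro: image_eqI[where x = "y / x"])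
qed

text \<open>Turns the order into field arithmetic. The infinite value of y = 0 is covered by 0 \<in>
  I, while x = 0 has to be excluded because y / 0 = 0 would lie in \<open>I\<close> too.\<close>

lemma val_less_iff: "val A x \<prec> val A y \<longleftrightarrow> x \<noteq> 0 \<and> y / x \<in> I"
proof (cases "x = 0")
  case True
  then show ?thesis by (auto simp: val_less_def psubset_eq val_subset_iff' )
next
  case False
  have "val A x \<prec> val A y \<longleftrightarrow> val A y \<subseteq> val A x \<and> \<not> val A x \<subseteq> val A y"
    by (auto simp: val_less_def)
  also have "\<dots> \<longleftrightarrow> y / x \<in> I"
    using False I_subset[of "y / x"] I_iff[of "y / x"] inverse_in_I[of "x / y"]
    by (auto simp: val_subset_iff')
  finally show ?thesis using False by simp
qed

lemma val_eq_iff: "val A x = val A y \<longleftrightarrow> x = 0 \<and> y = 0 \<or> x \<noteq> 0 \<and> y / x \<in> A - I"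
proof -
  have "val A x = val A y \<longleftrightarrow> val A y \<subseteq> val A x \<and> \<not> val A x \<prec> val A y"
    by (auto simp: val_less_def)
  then show ?thesis by (auto simp: val_less_iff val_subset_iff')
qed

end

section \<open>Rational functions and polynomials over a valuation domain\<close>

definition subst_fun :: "'a::field poly fract \<Rightarrow> 'a poly \<Rightarrow> 'a poly fract"
  where "subst_fun U p = poly (map_poly const_fun p) U"

lemma subst_fun_0 [simp]: "subst_fun U 0 = 0"
  by (simp add: subst_fun_def)

lemma subst_fun_pCons [simp]: "subst_fun U (pCons a p) = const_fun a + U * subst_fun U p"
  by (simp add: subst_fun_def map_poly_pCons)

lemma subst_fun_1 [simp]: "subst_fun U 1 = 1"
  by (simp add: one_pCons flip: to_fract_1)

lemma const_fun_add: "const_fun (a + b) = const_fun a + const_fun b"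
  by (simp flip: to_fract_add)

lemma const_fun_1: "const_fun 1 = 1"
  by (simp flip: one_pCons)

lemma const_fun_uminus: "const_fun (- a) = - const_fun a"
  using to_fract_uminus[of "[:a:]"] by simp

lemma const_fun_diff: "const_fun (a - b) = const_fun a - const_fun b"
  by (simp flip: to_fract_diff)

lemma const_fun_mult: "const_fun (a * b) = const_fun a * const_fun b"
  by (simp flip: to_fract_mult)

lemma const_fun_divide: "const_fun (a / b) = const_fun a / const_fun b"
proof (cases "b = 0")
  case False
  then have "const_fun (a / b) * const_fun b = const_fun a"
    by (simp flip: const_fun_mult)
  then show ?thesis using False by (simp add: field_simps)
qed simp

lemma subst_fun_add [simp]: "subst_fun U (p + q) = subst_fun U p + subst_fun U q"
  by (induction p q rule: poly_induct2) (simp_all add: const_fun_add algebra_simps)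

lemma subst_fun_smult [simp]: "subst_fun U (smult a p) = const_fun a * subst_fun U p"
  by (induction p) (simp_all add: const_fun_mult algebra_simps)

lemma subst_fun_mult [simp]: "subst_fun U (p * q) = subst_fun U p * subst_fun U q"
  by (induction p) (simp_all add: algebra_simps)

lemma subst_fun_uminus [simp]: "subst_fun U (- p) = - subst_fun U p"
  using subst_fun_add[of U p "- p"] by (simp del: subst_fun_add add: eq_neg_iff_add_eq_0 add.commute)

lemma subst_fun_diff [simp]: "subst_fun U (p - q) = subst_fun U p - subst_fun U q"
  using subst_fun_add[of U p "- q"] by simp

lemma subst_fun_monom [simp]: "subst_fun U (monom 1 n) = U ^ n"
  by (induction n) (simp_all add: monom_Suc monom_0 one_pCons[symmetric])

lemma subst_fun_pcompose: "subst_fun U (pcompose p q) = subst_fun (subst_fun U q) p"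
  by (induction p) (simp_all add: pcompose_pCons)

lemma subst_fun_var_X: "subst_fun var_X p = to_fract p"
proof (induction p)
  case (pCons a p)
  have "pCons a p = [:a:] + [:0, 1:] * p" by simp
  then have "to_fract (pCons a p) = const_fun a + var_X * to_fract p"
    by (metis to_fract_add to_fract_mult)
  then show ?case using pCons by simp
qed simp

section \<open>Values of a rational function at a point\<close>

lemma ratfun_value_cross:
  assumes "ratfun_value (Fract p q) a b" and "q \<noteq> 0"
  shows "b * poly q a = poly p a"
proof -
  \<comment> \<open>The value may be witnessed by another fraction, and \<open>q\<close> itself may
    vanish at \<open>a\<close>; hence a product formula and no quotient.\<close>
  obtain p' q' where e: "Fract p q = Fract p' q'" and n: "poly q' a \<noteq> 0" and b: "b = poly p' a / poly q' a"
    using assms by (auto simp: ratfun_value_def)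
  have "q' \<noteq> 0" using n by auto
  then have "p * q' = p' * q" using e assms(2) by (simp add: eq_fract)
  then have "poly p a * poly q' a = poly p' a * poly q a" by (metis poly_mult)
  then have "poly p a = b * poly q a" using b n by (metis nonzero_eq_divide_eq times_divide_eq_left)
  then show ?thesis by simp
qed

lemma ratfun_valueI: "poly q a \<noteq> 0 \<Longrightarrow> ratfun_value (Fract p q) a (poly p a / poly q a)"
  by (auto simp: ratfun_value_def)

lemma ratfun_valueE:
  assumes "ratfun_value \<phi> a b"
  obtains p q where "\<phi> = Fract p q" "poly q a \<noteq> 0" "b = poly p a / poly q a" "q \<noteq> 0"
proof -
  obtain p q where "\<phi> = Fract p q" "poly q a \<noteq> 0" "b = poly p a / poly q a"
    using assms unfolding ratfun_value_def by blast
  moreover from this have "q \<noteq> 0" by auto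
  ultimately show ?thesis using that by blast
qed

lemma ratfun_value_unique: "ratfun_value \<phi> a b \<Longrightarrow> ratfun_value \<phi> a b' \<Longrightarrow> b = b'"
  by (metis ratfun_valueE ratfun_value_cross nonzero_mult_div_cancel_right)

lemma ratfun_value_to_fract: "ratfun_value (to_fract p) a (poly p a)"
  unfolding ratfun_value_def by (intro exI[of _ p] exI[of _ 1]) (simp add: to_fract_def)

lemma ratfun_value_const: "ratfun_value (const_fun x) a x"
  using ratfun_value_to_fract[of "[:x:]" a] by simp

lemma ratfun_value_var_X: "ratfun_value var_X a a"
  using ratfun_value_to_fract[of "[:0, 1:]" a] by simp

lemma ratfun_value_add:
  assumes "ratfun_value \<phi> a b" "ratfun_value \<psi> a b'"
  shows "ratfun_value (\<phi> + \<psi>) a (b + b')"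
proof -
  obtain p q where 1: "\<phi> = Fract p q" "poly q a \<noteq> 0" "b = poly p a / poly q a" "q \<noteq> 0"
    using assms(1) by (rule ratfun_valueE)
  obtain p' q' where 2: "\<psi> = Fract p' q'" "poly q' a \<noteq> 0" "b' = poly p' a / poly q' a" "q' \<noteq> 0"
    using assms(2) by (rule ratfun_valueE)
  have "\<phi> + \<psi> = Fract (p * q' + p' * q) (q * q')" using 1 2 by simp
  moreover have "b + b' = poly (p * q' + p' * q) a / poly (q * q') a"
    using 1 2 by (simp add: add_frac_eq)
  ultimately show ?thesis using ratfun_valueI[of "q * q'" a "p * q' + p' * q"] 1 2 by simp
qed

lemma ratfun_value_mult:
  assumes "ratfun_value \<phi> a b" "ratfun_value \<psi> a b'"
  shows "ratfun_value (\<phi> * \<psi>) a (b * b')"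
proof -
  obtain p q where 1: "\<phi> = Fract p q" "poly q a \<noteq> 0" "b = poly p a / poly q a" "q \<noteq> 0"
    using assms(1) by (rule ratfun_valueE)
  obtain p' q' where 2: "\<psi> = Fract p' q'" "poly q' a \<noteq> 0" "b' = poly p' a / poly q' a" "q' \<noteq> 0"
    using assms(2) by (rule ratfun_valueE)
  have "\<phi> * \<psi> = Fract (p * p') (q * q')" using 1 2 by simp
  then show ?thesis using ratfun_valueI[of "q * q'" a "p * p'"] 1 2 by simp
qed

lemma ratfun_value_uminus:
  assumes "ratfun_value \<phi> a b" shows "ratfun_value (- \<phi>) a (- b)"
proof -
  obtain p q where 1: "\<phi> = Fract p q" "poly q a \<noteq> 0" "b = poly p a / poly q a" "q \<noteq> 0"
    using assms by (rule ratfun_valueE)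
  then show ?thesis using ratfun_valueI[of q a "- p"] by simp
qed

lemma ratfun_value_diff:
  "ratfun_value \<phi> a b \<Longrightarrow> ratfun_value \<psi> a b' \<Longrightarrow> ratfun_value (\<phi> - \<psi>) a (b - b')"
  using ratfun_value_add[of \<phi> a b "- \<psi>" "- b'"] by (simp add: ratfun_value_uminus)

lemma ratfun_value_inverse:
  assumes "ratfun_value \<phi> a b" "b \<noteq> 0"
  shows "ratfun_value (inverse \<phi>) a (inverse b)"
proof -
  obtain p q where 1: "\<phi> = Fract p q" "poly q a \<noteq> 0" "b = poly p a / poly q a" "q \<noteq> 0"
    using assms(1) by (rule ratfun_valueE)
  then show ?thesis using ratfun_valueI[of p a q] assms(2) by simp
qed

lemma ratfun_value_divide:
  "ratfun_value \<phi> a b \<Longrightarrow> ratfun_value \<psi> a b' \<Longrightarrow> b' \<noteq> 0 \<Longrightarrow> ratfun_value (\<phi> / \<psi>) a (b / b')"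
  using ratfun_value_mult[OF _ ratfun_value_inverse] by (simp add: divide_inverse)

lemma ratfun_value_subst_fun:
  "ratfun_value U a r \<Longrightarrow> ratfun_value (subst_fun U p) a (poly p r)"
proof (induction p)
  case 0
  then show ?case using ratfun_value_const[of 0 a] by simp
next
  case (pCons x p)
  then show ?case by (simp add: ratfun_value_add ratfun_value_mult ratfun_value_const)
qed

section \<open>Polynomials with coefficients in a valuation domain or in its maximal ideal\<close>

definition poly_over :: "'a::zero set \<Rightarrow> 'a poly \<Rightarrow> bool"
  where "poly_over S p \<longleftrightarrow> (\<forall>i. coeff p i \<in> S)"

lemma poly_over_pCons [simp]: "poly_over S (pCons a p) \<longleftrightarrow> a \<in> S \<and> poly_over S p"
proof -
  have "poly_over S (pCons a p) \<longleftrightarrow> (\<forall>i. (case i of 0 \<Rightarrow> a | Suc j \<Rightarrow> coeff p j) \<in> S)"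
    by (simp add: poly_over_def coeff_pCons)
  also have "\<dots> \<longleftrightarrow> a \<in> S \<and> poly_over S p"
    by (auto simp: poly_over_def split: nat.split)
  finally show ?thesis .
qed

context valuation_max
begin

lemma poly_over_0 [simp]: "poly_over A 0" "poly_over I 0"
  by (auto simp: poly_over_def)

lemma poly_over_1 [simp]: "poly_over A 1"
  by (simp add: one_pCons)

lemma poly_over_I: "poly_over I p \<Longrightarrow> poly_over A p"
  by (auto simp: poly_over_def I_subset)

lemma poly_over_add [simp]:
  "poly_over A p \<Longrightarrow> poly_over A q \<Longrightarrow> poly_over A (p + q)"
  "poly_over I p \<Longrightarrow> poly_over I q \<Longrightarrow> poly_over I (p + q)"
  by (auto simp: poly_over_def I_add)

lemma poly_over_diff [simp]:
  "poly_over A p \<Longrightarrow> poly_over A q \<Longrightarrow> poly_over A (p - q)"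
  "poly_over I p \<Longrightarrow> poly_over I q \<Longrightarrow> poly_over I (p - q)"
  by (auto simp: poly_over_def I_diff)

lemma poly_over_smult [simp]:
  "a \<in> A \<Longrightarrow> poly_over A p \<Longrightarrow> poly_over A (smult a p)"
  "a \<in> A \<Longrightarrow> poly_over I p \<Longrightarrow> poly_over I (smult a p)"
  "a \<in> I \<Longrightarrow> poly_over A p \<Longrightarrow> poly_over I (smult a p)"
  by (auto simp: poly_over_def I_mult I_mult')

lemma poly_over_mult [simp]: "poly_over A p \<Longrightarrow> poly_over A q \<Longrightarrow> poly_over A (p * q)"
  by (induction p) auto

lemma poly_over_mult_I: "poly_over I p \<Longrightarrow> poly_over A q \<Longrightarrow> poly_over I (p * q)"
  by (induction p) auto

lemma poly_over_monom [simp]: "poly_over A (monom 1 n)"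
  by (auto simp: poly_over_def)

lemma poly_over_pcompose [simp]:
  "poly_over A p \<Longrightarrow> poly_over A q \<Longrightarrow> poly_over A (pcompose p q)"
  by (induction p) (auto simp: pcompose_pCons)

lemma poly_in_A: "poly_over A p \<Longrightarrow> x \<in> A \<Longrightarrow> poly p x \<in> A"
  by (induction p) auto

lemma poly_in_I: "poly_over I p \<Longrightarrow> x \<in> A \<Longrightarrow> poly p x \<in> I"
  by (induction p) (auto intro!: I_add I_mult')

text \<open>All terms but the constant one are multiples of x, so p(x) is congruent modulo
  \<open>I\<close> to the constant coefficient.\<close>

lemma poly_notin_I:
  assumes "poly_over A p" "coeff p 0 \<notin> I" "x \<in> I"
  shows "poly p x \<notin> I"
proof (cases p)
  case (pCons a q)
  have "x * poly q x \<in> I" using assms pCons by (simp add: I_mult I_subset poly_in_A)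
  then show ?thesis using assms(2) pCons I_diff[of "poly p x" "x * poly q x"] by auto
qed

text \<open>Divisibility in a valuation domain is total, and y / x \<in> A says v(x) \<le>
  v(y).\<close>

lemma min_value_exists:
  assumes "finite S" "S \<noteq> {}" "0 \<notin> S"
  shows "\<exists>x\<in>S. \<forall>y\<in>S. y / x \<in> A"
  using assms
proof (induction rule: finite_ne_induct)
  case (insert z S)
  then obtain x where x: "x \<in> S" "\<forall>y\<in>S. y / x \<in> A" by auto
  show ?case
  proof (cases "z / x \<in> A")
    case False
    then have "x / z \<in> A" using inverse_closed by fastforce
    moreover have "x \<noteq> 0" using x insert.prems by auto
    ultimately have "y / z \<in> A" if "y \<in> S" for y
      using mult_closed[of "y / x" "x / z"] x that by simp
    moreover have "z / z \<in> A" using insert.prems by auto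
    ultimately show ?thesis by blast
  qed (use x in auto)
qed auto

text \<open>Dividing both polynomials by a nonzero coefficient of least value keeps all coefficients
  in \<open>A\<close> and turns one of them into 1.\<close>

lemma primitive_pair:
  assumes "p \<noteq> 0 \<or> q \<noteq> 0"
  obtains a where "a \<noteq> 0" "poly_over A (smult a p)" "poly_over A (smult a q)"
    "\<not> (poly_over I (smult a p) \<and> poly_over I (smult a q))"
proof -
  define S where "S = (set (coeffs p) \<union> set (coeffs q)) - {0}"
  have S: "y \<in> S \<longleftrightarrow> y \<noteq> 0 \<and> ((\<exists>i. coeff p i = y) \<or> (\<exists>i. coeff q i = y))" for y
    using range_coeff[of p] range_coeff[of q] unfolding S_def by (auto simp: set_eq_iff image_iff)
  have "lead_coeff p \<in> S \<or> lead_coeff q \<in> S" using assms unfolding S by auto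
  then obtain x where x: "x \<in> S" "\<forall>y\<in>S. y / x \<in> A"
    using min_value_exists[of S] unfolding S_def by blast
  have x0: "x \<noteq> 0" using x S by blast
  have in_A: "coeff p i / x \<in> A" "coeff q i / x \<in> A" for i
    using x(2) S by (cases "coeff p i = 0"; cases "coeff q i = 0"; force)+
  have "(\<exists>i. inverse x * coeff p i = 1) \<or> (\<exists>i. inverse x * coeff q i = 1)"
    using x(1) x0 unfolding S by (metis left_inverse)
  then have "\<not> (poly_over I (smult (inverse x) p) \<and> poly_over I (smult (inverse x) q))"
    using one_notin_I unfolding poly_over_def coeff_smult by metis
  moreover have "poly_over A (smult (inverse x) p)" "poly_over A (smult (inverse x) q)"
    using in_A by (simp_all add: poly_over_def field_simps)
  ultimately show ?thesis using that[of "inverse x"] x0 by simp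
qed

text \<open>The exponent \<open>d\<close> is the order at 0 of the reduction of \<open>p\<close>
  modulo \<open>I\<close>: the coefficients below \<open>d\<close> lie in \<open>I\<close> and form
  \<open>p0\<close>, while \<open>p1\<close> starts with the first coefficient outside
  \<open>I\<close>.\<close>

lemma poly_lowest_term:
  "poly_over A p \<Longrightarrow> \<not> poly_over I p \<Longrightarrow>
    \<exists>d p1 p0. p = monom 1 d * p1 + p0 \<and> poly_over A p1 \<and> coeff p1 0 \<notin> I \<and> poly_over I p0"
proof (induction p)
  case (pCons a p)
  show ?case
  proof (cases "a \<in> I")
    case True
    then obtain d p1 p0 where "p = monom 1 d * p1 + p0" "poly_over A p1" "coeff p1 0 \<notin> I" "poly_over I p0"
      using pCons by auto
    then show ?thesis
      using True by (intro exI[of _ "Suc d"] exI[of _ p1] exI[of _ "pCons a p0"]) (simp add: monom_Suc)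
  next
    case False
    then show ?thesis
      using pCons.prems by (intro exI[of _ 0] exI[of _ "pCons a p"] exI[of _ 0]) (simp add: monom_0 one_pCons[symmetric])
  qed
qed simp

lemma poly_over_synthetic_div:
  "poly_over A p \<Longrightarrow> x \<in> A \<Longrightarrow> poly_over A (synthetic_div p x)"
  by (induction p) (auto simp: poly_in_A)

text \<open>A nonzero polynomial over the residue field has only finitely many roots, so it does not
  vanish along a sequence that eventually leaves every residue class.\<close>

lemma eventually_poly_notin_I:
  assumes r: "eventually (\<lambda>\<nu>. r \<nu> \<in> A) G"
    and avoid: "\<And>x. x \<in> A \<Longrightarrow> eventually (\<lambda>\<nu>. r \<nu> - x \<notin> I) G"
    and p: "poly_over A p" "\<not> poly_over I p"
  shows "eventually (\<lambda>\<nu>. poly p (r \<nu>) \<notin> I) G"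
  using p
proof (induction "degree p" arbitrary: p rule: less_induct)
  case less
  show ?case
  proof (cases "\<exists>x\<in>A. poly p x \<in> I")
    case False
    then show ?thesis using r by (auto elim: eventually_mono)
  next
    case True
    then obtain x where x: "x \<in> A" "poly p x \<in> I" by blast
    define q where "q = synthetic_div p x"
    have pq: "p = [:- x, 1:] * q + [:poly p x:]"
      unfolding q_def by (rule synthetic_div_correct'[symmetric])
    have q: "poly_over A q" using less.prems x poly_over_synthetic_div by (simp add: q_def)
    \<comment> \<open>If the quotient reduced to 0, so would p = (X - x) q + p(x), since p(x) is in
      \<open>I\<close>.\<close>
    have q': "\<not> poly_over I q"
    proof
      assume "poly_over I q"
      then have "poly_over I (q * [:- x, 1:] + [:poly p x:])"
        using x by (intro poly_over_add poly_over_mult_I) auto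
      then show False using less.prems pq by (metis mult.commute)
    qed
    have "degree p \<noteq> 0"
    proof
      assume "degree p = 0"
      then have "q = 0" by (simp add: q_def synthetic_div_eq_0_iff)
      then show False using q' by simp
    qed
    then have "degree q < degree p" by (simp add: q_def degree_synthetic_div)
    then have "eventually (\<lambda>\<nu>. poly q (r \<nu>) \<notin> I) G" using less.hyps q q' by blast
    then show ?thesis using r avoid[OF x(1)]
    proof eventually_elim
      case (elim \<nu>)
      have "poly p (r \<nu>) = (r \<nu> - x) * poly q (r \<nu>) + poly p x"
        by (subst pq) (simp add: algebra_simps)
      moreover have "(r \<nu> - x) * poly q (r \<nu>) \<notin> I"
        using elim x q I_prime poly_in_A by blast
      ultimately show ?case using x I_diff[of "poly p (r \<nu>)" "poly p x"] by auto
    qed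
  qed
qed

end

section \<open>Gauss extensions\<close>

text \<open>The filter of final segments: conditions that hold for large indices can then be
  combined by filter rules, without choosing maxima of indices.\<close>

definition tail :: "'i::wellorder set \<Rightarrow> 'i filter"
  where "tail \<Lambda> = (INF N\<in>\<Lambda>. principal {\<nu>\<in>\<Lambda>. N \<le> \<nu>})"

lemma for_large_iff_eventually:
  assumes "index_set \<Lambda>"
  shows "for_large \<Lambda> P \<longleftrightarrow> eventually P (tail \<Lambda>)"
proof -
  have "eventually P (tail \<Lambda>) \<longleftrightarrow> (\<exists>N\<in>\<Lambda>. eventually P (principal {\<nu>\<in>\<Lambda>. N \<le> \<nu>}))"
    unfolding tail_def
  proof (rule eventually_INF_base)
    show "\<Lambda> \<noteq> {}" using assms by (simp add: index_set_def)
    show "\<exists>x\<in>\<Lambda>. principal {\<nu> \<in> \<Lambda>. x \<le> \<nu>} \<le> inf (principal {\<nu> \<in> \<Lambda>. a \<le> \<nu>}) (principal {\<nu> \<in> \<Lambda>. b \<le> \<nu>})"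
      if "a \<in> \<Lambda>" "b \<in> \<Lambda>" for a b
      using that by (intro bexI[of _ "max a b"]) (auto simp: max_def)
  qed
  then show ?thesis by (auto simp: for_large_def eventually_principal)
qed

lemma eventually_tail_iff:
  "index_set \<Lambda> \<Longrightarrow> eventually P (tail \<Lambda>) \<longleftrightarrow> (\<exists>N\<in>\<Lambda>. \<forall>\<nu>\<in>\<Lambda>. N \<le> \<nu> \<longrightarrow> P \<nu>)"
  by (simp flip: for_large_iff_eventually add: for_large_def)

lemma tail_neq_bot: "index_set \<Lambda> \<Longrightarrow> tail \<Lambda> \<noteq> bot"
  unfolding trivial_limit_def by (auto simp: eventually_tail_iff)

definition filter_domain :: "'a::field set \<Rightarrow> 'i filter \<Rightarrow> ('i \<Rightarrow> 'a) \<Rightarrow> 'a poly fract set"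
  where "filter_domain V G s = {\<phi>. eventually (\<lambda>\<nu>. \<exists>b\<in>V. ratfun_value \<phi> (s \<nu>) b) G}"

lemma seq_domain_eq_filter_domain:
  "index_set \<Lambda> \<Longrightarrow> seq_domain V \<Lambda> s = filter_domain V (tail \<Lambda>) s"
  by (simp add: seq_domain_def filter_domain_def for_large_iff_eventually)

text \<open>Says that K(U) = K(X).\<close>

definition generates :: "'a::field poly fract \<Rightarrow> bool"
  where "generates U \<longleftrightarrow> (\<forall>\<phi>. \<exists>p q. subst_fun U q \<noteq> 0 \<and> \<phi> = subst_fun U p / subst_fun U q)"

context valuation_max
begin

lemma filter_domainI:
  "eventually (\<lambda>\<nu>. ratfun_value \<phi> (s \<nu>) (b \<nu>)) G \<Longrightarrow> eventually (\<lambda>\<nu>. b \<nu> \<in> A) G \<Longrightarrow>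
    \<phi> \<in> filter_domain A G s"
  unfolding filter_domain_def mem_Collect_eq by (erule (1) eventually_elim2) blast

lemma filter_domainE:
  assumes "\<phi> \<in> filter_domain A G s"
  obtains b where "eventually (\<lambda>\<nu>. ratfun_value \<phi> (s \<nu>) (b \<nu>)) G" "eventually (\<lambda>\<nu>. b \<nu> \<in> A) G"
proof -
  define b where "b \<nu> = (SOME b. b \<in> A \<and> ratfun_value \<phi> (s \<nu>) b)" for \<nu>
  have "eventually (\<lambda>\<nu>. b \<nu> \<in> A \<and> ratfun_value \<phi> (s \<nu>) (b \<nu>)) G"
    using assms unfolding filter_domain_def mem_Collect_eq
  proof eventually_elim
    case (elim \<nu>)
    then show ?case
      unfolding b_def using someI_ex[of "\<lambda>b. b \<in> A \<and> ratfun_value \<phi> (s \<nu>) b"] by blast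
  qed
  then show ?thesis by (intro that[of b]) (simp_all add: eventually_conj_iff)
qed

lemma filter_domain_const: "x \<in> A \<Longrightarrow> const_fun x \<in> filter_domain A G s"
  by (rule filter_domainI[where b = "\<lambda>_. x"]) (simp_all add: ratfun_value_const)

lemma filter_domain_add:
  assumes "\<phi> \<in> filter_domain A G s" "\<psi> \<in> filter_domain A G s"
  shows "\<phi> + \<psi> \<in> filter_domain A G s"
proof -
  obtain b where b: "eventually (\<lambda>\<nu>. ratfun_value \<phi> (s \<nu>) (b \<nu>)) G" "eventually (\<lambda>\<nu>. b \<nu> \<in> A) G"
    using assms(1) by (rule filter_domainE)
  obtain b' where b': "eventually (\<lambda>\<nu>. ratfun_value \<psi> (s \<nu>) (b' \<nu>)) G" "eventually (\<lambda>\<nu>. b' \<nu> \<in> A) G"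
    using assms(2) by (rule filter_domainE)
  have "eventually (\<lambda>\<nu>. ratfun_value (\<phi> + \<psi>) (s \<nu>) (b \<nu> + b' \<nu>)) G"
    using b(1) b'(1) by eventually_elim (rule ratfun_value_add)
  moreover have "eventually (\<lambda>\<nu>. b \<nu> + b' \<nu> \<in> A) G"
    using b(2) b'(2) by eventually_elim (rule add_closed)
  ultimately show ?thesis by (rule filter_domainI)
qed

lemma filter_domain_mult:
  assumes "\<phi> \<in> filter_domain A G s" "\<psi> \<in> filter_domain A G s"
  shows "\<phi> * \<psi> \<in> filter_domain A G s"
proof -
  obtain b where b: "eventually (\<lambda>\<nu>. ratfun_value \<phi> (s \<nu>) (b \<nu>)) G" "eventually (\<lambda>\<nu>. b \<nu> \<in> A) G"
    using assms(1) by (rule filter_domainE)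
  obtain b' where b': "eventually (\<lambda>\<nu>. ratfun_value \<psi> (s \<nu>) (b' \<nu>)) G" "eventually (\<lambda>\<nu>. b' \<nu> \<in> A) G"
    using assms(2) by (rule filter_domainE)
  have "eventually (\<lambda>\<nu>. ratfun_value (\<phi> * \<psi>) (s \<nu>) (b \<nu> * b' \<nu>)) G"
    using b(1) b'(1) by eventually_elim (rule ratfun_value_mult)
  moreover have "eventually (\<lambda>\<nu>. b \<nu> * b' \<nu> \<in> A) G"
    using b(2) b'(2) by eventually_elim (rule mult_closed)
  ultimately show ?thesis by (rule filter_domainI)
qed

lemma filter_domain_uminus: "\<phi> \<in> filter_domain A G s \<Longrightarrow> - \<phi> \<in> filter_domain A G s"
  using filter_domain_mult[OF filter_domain_const[of "-1"], of \<phi> G s]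
  by (simp add: const_fun_uminus const_fun_1)

lemma filter_domain_subring: "subring (filter_domain A G s) ring_of_type_algebra"
proof -
  interpret R: ring "ring_of_type_algebra :: 'f poly fract ring" by rule
  show ?thesis
    using filter_domain_const[of 1]
    by (intro R.subringI)
      (auto simp: ring_of_type_algebra_sel a_inv_ring_of_type_algebra one_pCons[symmetric]
        intro: filter_domain_add filter_domain_mult filter_domain_uminus)
qed

lemma primitive_representation:
  assumes "generates U"
  obtains p q where "poly_over A p" "poly_over A q" "\<not> (poly_over I p \<and> poly_over I q)"
    "subst_fun U q \<noteq> 0" "\<phi> = subst_fun U p / subst_fun U q"
proof -
  obtain p q where pq: "subst_fun U q \<noteq> 0" "\<phi> = subst_fun U p / subst_fun U q"
    using assms unfolding generates_def by blast
  then have "q \<noteq> 0" by auto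
  then obtain a where "a \<noteq> 0" "poly_over A (smult a p)" "poly_over A (smult a q)"
    "\<not> (poly_over I (smult a p) \<and> poly_over I (smult a q))"
    using primitive_pair by blast
  then show ?thesis using pq that[of "smult a p" "smult a q"] by simp
qed

end

text \<open>\<open>W\<close> is the Gauss extension of \<open>V\<close> with respect to
  \<open>U\<close>: by the last condition the residue of p(U) vanishes only if p reduces to 0, so
  the residue of \<open>U\<close> is transcendental over that of \<open>V\<close>.\<close>

locale gauss_parameter = V: valuation_max V M + W: valuation_max W N
  for V M :: "'a::field set" and W N :: "'a poly fract set" +
  fixes U :: "'a poly fract"
  assumes generates: "generates U"
    and subst_closed: "poly_over V p \<Longrightarrow> subst_fun U p \<in> W"
    and subst_in_N_iff: "poly_over V p \<Longrightarrow> subst_fun U p \<in> N \<longleftrightarrow> poly_over M p"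
begin

lemma U_closed: "U \<in> W"
  using subst_closed[of "[:0, 1:]"] by (simp add: one_pCons[symmetric])

lemma subst_nonzero: "poly_over V p \<Longrightarrow> \<not> poly_over M p \<Longrightarrow> subst_fun U p \<noteq> 0"
  using subst_in_N_iff[of p] by auto

text \<open>In a primitive representation p / q of \<phi>, having q in M[U] would give p(U) = \<phi>
  q(U) in \<open>N\<close>, hence p in M[U], against primitivity.\<close>

lemma representation:
  assumes "\<phi> \<in> W"
  obtains p q where "poly_over V p" "poly_over V q" "\<not> poly_over M q"
    "\<phi> = subst_fun U p / subst_fun U q"
proof -
  obtain p q where pq: "poly_over V p" "poly_over V q" "\<not> (poly_over M p \<and> poly_over M q)"
    "subst_fun U q \<noteq> 0" "\<phi> = subst_fun U p / subst_fun U q"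
    using V.primitive_representation[OF generates] .
  have "\<not> poly_over M q"
  proof
    assume q: "poly_over M q"
    then have "subst_fun U q \<in> N" using pq subst_in_N_iff by simp
    then have "\<phi> * subst_fun U q \<in> N" using assms W.I_mult' by blast
    then show False using pq q subst_in_N_iff by simp
  qed
  then show ?thesis using that pq by blast
qed

end

section \<open>Sequences leaving every residue class define Gauss extensions\<close>

locale transcendental_residue = valuation_max A I
  for A I :: "'a::field set" +
  fixes G :: "'i filter" and s :: "'i \<Rightarrow> 'a"
  assumes G_nontrivial: "G \<noteq> bot"
begin

text \<open>A condition on values that forces the residue of \<open>U\<close> to be transcendental:
  by \<open>eventually_poly_notin_I\<close>, polynomials with nonzero reduction eventually take unit
  values.\<close>

definition avoids_residues :: "'a poly fract \<Rightarrow> bool"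
  where "avoids_residues U \<longleftrightarrow> (\<exists>r. eventually (\<lambda>\<nu>. ratfun_value U (s \<nu>) (r \<nu>)) G \<and>
    eventually (\<lambda>\<nu>. r \<nu> \<in> A) G \<and> (\<forall>x\<in>A. eventually (\<lambda>\<nu>. r \<nu> - x \<notin> I) G))"

lemma subst_in_filter_domain:
  assumes "avoids_residues U" "poly_over A p"
  shows "subst_fun U p \<in> filter_domain A G s"
proof -
  obtain r where r: "eventually (\<lambda>\<nu>. ratfun_value U (s \<nu>) (r \<nu>)) G" "eventually (\<lambda>\<nu>. r \<nu> \<in> A) G"
    using assms by (auto simp: avoids_residues_def)
  have "eventually (\<lambda>\<nu>. ratfun_value (subst_fun U p) (s \<nu>) (poly p (r \<nu>))) G"
    using r(1) by eventually_elim (rule ratfun_value_subst_fun)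
  moreover have "eventually (\<lambda>\<nu>. poly p (r \<nu>) \<in> A) G"
    using r(2) by eventually_elim (use assms poly_in_A in blast)
  ultimately show ?thesis by (rule filter_domainI)
qed

text \<open>The values p(r) are eventually units, so their inverses stay in \<open>A\<close>. Were
  p(U) = 0, they would be 0 and outside \<open>I\<close> at once, impossible along a nontrivial
  filter.\<close>

lemma subst_nonzero_inverse:
  assumes "avoids_residues U" "poly_over A p" "\<not> poly_over I p"
  shows "subst_fun U p \<noteq> 0 \<and> inverse (subst_fun U p) \<in> filter_domain A G s"
proof -
  obtain r where r: "eventually (\<lambda>\<nu>. ratfun_value U (s \<nu>) (r \<nu>)) G" "eventually (\<lambda>\<nu>. r \<nu> \<in> A) G"
    "\<And>x. x \<in> A \<Longrightarrow> eventually (\<lambda>\<nu>. r \<nu> - x \<notin> I) G"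
    using assms by (auto simp: avoids_residues_def)
  have p: "eventually (\<lambda>\<nu>. poly p (r \<nu>) \<notin> I) G"
    using eventually_poly_notin_I[of r G p] r(2,3) assms(2,3) by blast
  have v: "eventually (\<lambda>\<nu>. ratfun_value (subst_fun U p) (s \<nu>) (poly p (r \<nu>))) G"
    using r(1) by eventually_elim (rule ratfun_value_subst_fun)
  have "eventually (\<lambda>\<nu>. ratfun_value (inverse (subst_fun U p)) (s \<nu>) (inverse (poly p (r \<nu>)))) G"
    using v p by eventually_elim (rule ratfun_value_inverse, auto)
  moreover have "eventually (\<lambda>\<nu>. inverse (poly p (r \<nu>)) \<in> A) G"
    using r(2) p by eventually_elim (use assms poly_in_A inverse_notin_I_closed in blast)
  ultimately have "inverse (subst_fun U p) \<in> filter_domain A G s" by (rule filter_domainI)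
  moreover have "subst_fun U p \<noteq> 0"
  proof
    assume z: "subst_fun U p = 0"
    have "eventually (\<lambda>\<nu>. False) G" using v p
    proof eventually_elim
      case (elim \<nu>)
      have "ratfun_value (subst_fun U p) (s \<nu>) 0"
        using z ratfun_value_const[of 0] by simp
      then have "poly p (r \<nu>) = 0" using elim(1) ratfun_value_unique by blast
      then show ?case using elim(2) by simp
    qed
    then show False using G_nontrivial by simp
  qed
  ultimately show ?thesis by simp
qed

lemma subst_inverse_notin:
  assumes "avoids_residues U" "poly_over I p" "subst_fun U p \<noteq> 0"
  shows "inverse (subst_fun U p) \<notin> filter_domain A G s"
proof
  assume "inverse (subst_fun U p) \<in> filter_domain A G s"
  then obtain b where b: "eventually (\<lambda>\<nu>. ratfun_value (inverse (subst_fun U p)) (s \<nu>) (b \<nu>)) G"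
    "eventually (\<lambda>\<nu>. b \<nu> \<in> A) G" by (rule filter_domainE)
  obtain r where r: "eventually (\<lambda>\<nu>. ratfun_value U (s \<nu>) (r \<nu>)) G" "eventually (\<lambda>\<nu>. r \<nu> \<in> A) G"
    using assms by (auto simp: avoids_residues_def)
  have "eventually (\<lambda>\<nu>. False) G" using b r
  proof eventually_elim
    case (elim \<nu>)
    have "ratfun_value (inverse (subst_fun U p) * subst_fun U p) (s \<nu>) (b \<nu> * poly p (r \<nu>))"
      using elim ratfun_value_mult ratfun_value_subst_fun by blast
    then have "ratfun_value 1 (s \<nu>) (b \<nu> * poly p (r \<nu>))" using assms(3) by simp
    moreover have "ratfun_value 1 (s \<nu>) 1"
      using ratfun_value_const[of 1] by (simp add: const_fun_1)
    ultimately have "b \<nu> * poly p (r \<nu>) = 1" by (rule ratfun_value_unique)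
    moreover have "b \<nu> * poly p (r \<nu>) \<in> I"
      using elim assms(2) poly_in_I I_mult' by blast
    ultimately show ?case using one_notin_I by simp
  qed
  then show False using G_nontrivial by simp
qed

text \<open>In a primitive representation p or q has nonzero reduction; its value at
  \<open>U\<close> is a unit of the domain, and the fraction with this denominator lies in the
  domain.\<close>

lemma filter_domain_valuation_domain:
  assumes U: "avoids_residues U" "generates U"
  shows "valuation_domain_of (filter_domain A G s)"
  unfolding valuation_domain_of_def
proof (intro conjI allI impI filter_domain_subring)
  fix \<phi>
  obtain p q where pq: "poly_over A p" "poly_over A q" "\<not> (poly_over I p \<and> poly_over I q)"
    "subst_fun U q \<noteq> 0" "\<phi> = subst_fun U p / subst_fun U q"
    using primitive_representation[OF U(2)] .
  show "\<phi> \<in> filter_domain A G s \<or> inverse \<phi> \<in> filter_domain A G s"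
  proof (cases "poly_over I q")
    case True
    then have "subst_fun U q * inverse (subst_fun U p) \<in> filter_domain A G s"
      using pq U subst_in_filter_domain subst_nonzero_inverse filter_domain_mult by blast
    then show ?thesis using pq by (simp add: divide_inverse mult.commute)
  next
    case False
    then have "subst_fun U p * inverse (subst_fun U q) \<in> filter_domain A G s"
      using pq U subst_in_filter_domain subst_nonzero_inverse filter_domain_mult by blast
    then show ?thesis using pq by (simp add: divide_inverse)
  qed
qed

text \<open>As \<open>N\<close> consists of the non-units, \<open>subst_nonzero_inverse\<close> and
  \<open>subst_inverse_notin\<close> decide whether p(U) belongs to it.\<close>

lemma gauss_parameterI:
  assumes U: "avoids_residues U" "generates U"
    and N: "maximalideal N (ring_on (filter_domain A G s))"
  shows "gauss_parameter A I (filter_domain A G s) N U"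
proof -
  interpret W: valuation_max "filter_domain A G s" N
    using filter_domain_valuation_domain[OF U] N by (rule valuation_max.intro)
  show ?thesis
  proof (intro gauss_parameter.intro gauss_parameter_axioms.intro
      valuation_max_axioms W.valuation_max_axioms)
    fix p assume p: "poly_over A p"
    show "subst_fun U p \<in> filter_domain A G s" using p U subst_in_filter_domain by blast
    show "subst_fun U p \<in> N \<longleftrightarrow> poly_over I p"
      using p U subst_nonzero_inverse subst_inverse_notin W.I_iff by blast
  qed (use U in auto)
qed

end

section \<open>The residue field of a Gauss extension: k(u) with u transcendental, and localizations
  of k[u]\<close>

context gauss_parameter
begin

text \<open>The copy of V / M inside the residue field of \<open>W\<close>. The formula does not
  involve \<open>U\<close>, so all parameters of the same \<open>W\<close> yield the same
  set.\<close>

definition k :: "'a poly fract set set"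
  where "k = W.res ` const_fun ` V"

lemma const_closed: "x \<in> V \<Longrightarrow> const_fun x \<in> W"
  using subst_closed[of "[:x:]"] by simp

lemma const_in_N_iff: "x \<in> V \<Longrightarrow> const_fun x \<in> N \<longleftrightarrow> x \<in> M"
  using subst_in_N_iff[of "[:x:]"] by simp

lemma subring_k: "subring k W.L"
proof (rule W.L.subringI)
  show "k \<subseteq> carrier W.L" using const_closed by (auto simp: k_def)
  show "\<one>\<^bsub>W.L\<^esub> \<in> k" unfolding k_def W.res_one[symmetric] const_fun_1[symmetric] by blast
  fix a assume "a \<in> k"
  then obtain x where x: "x \<in> V" "a = W.res (const_fun x)" by (auto simp: k_def)
  then have "\<ominus>\<^bsub>W.L\<^esub> a = W.res (const_fun (- x))"
    using const_closed by (simp add: const_fun_uminus W.res_uminus)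
  then show "\<ominus>\<^bsub>W.L\<^esub> a \<in> k" using x by (auto simp: k_def)
  fix b assume "b \<in> k"
  then obtain y where y: "y \<in> V" "b = W.res (const_fun y)" by (auto simp: k_def)
  have "a \<otimes>\<^bsub>W.L\<^esub> b = W.res (const_fun (x * y))"
    using x y const_closed by (simp only: const_fun_mult W.res_mult)
  then show "a \<otimes>\<^bsub>W.L\<^esub> b \<in> k" using x y by (auto simp: k_def)
  have "a \<oplus>\<^bsub>W.L\<^esub> b = W.res (const_fun (x + y))"
    using x y const_closed by (simp only: const_fun_add W.res_add)
  then show "a \<oplus>\<^bsub>W.L\<^esub> b \<in> k" using x y by (auto simp: k_def)
qed

lemma res_subst_pCons:
  "a \<in> V \<Longrightarrow> poly_over V p \<Longrightarrow>
    W.res (subst_fun U (pCons a p)) = W.res (subst_fun U p) \<otimes>\<^bsub>W.L\<^esub> W.res U \<oplus>\<^bsub>W.L\<^esub> W.res (const_fun a)"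
  using const_closed subst_closed U_closed
  by (simp add: W.res_add W.res_mult W.L.m_comm W.L.a_comm)

text \<open>The inductive rule of \<open>simple_extension\<close> is a Horner step x u + a, which
  corresponds to \<open>pCons a\<close> on polynomials over \<open>V\<close>.\<close>

lemma simple_extension_eq:
  "ring.simple_extension W.L k (W.res U) = {W.res (subst_fun U p) | p. poly_over V p}"
proof (intro equalityI subsetI)
  fix x assume "x \<in> W.L.simple_extension k (W.res U)"
  then show "x \<in> {W.res (subst_fun U p) | p. poly_over V p}"
  proof (induction rule: W.L.simple_extension.induct)
    case zero
    show ?case using W.res_zero V.poly_over_0(1) subst_fun_0[of U] by (metis (mono_tags, lifting) mem_Collect_eq)
  next
    case (lin x y)
    then obtain p a where "x = W.res (subst_fun U p)" "poly_over V p" "a \<in> V" "y = W.res (const_fun a)"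
      by (auto simp: k_def)
    then show ?case using res_subst_pCons[of a p, symmetric] by (auto intro!: exI[of _ "pCons a p"] simp del: subst_fun_pCons)
  qed
next
  fix x assume "x \<in> {W.res (subst_fun U p) | p. poly_over V p}"
  then obtain p where p: "x = W.res (subst_fun U p)" "poly_over V p" by blast
  from p(2) have "W.res (subst_fun U p) \<in> W.L.simple_extension k (W.res U)"
  proof (induction p)
    case (pCons a p)
    then show ?case
      by (simp add: res_subst_pCons del: subst_fun_pCons)
        (auto simp: k_def intro: W.L.simple_extension.lin)
  qed (simp add: W.res_zero)
  then show "x \<in> W.L.simple_extension k (W.res U)" using p by simp
qed

lemma generate_field_eq: "carrier W.L = generate_field W.L (insert (W.res U) k)"
proof
  have sub: "insert (W.res U) k \<subseteq> carrier W.L"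
    using U_closed subringE(1)[OF subring_k] by auto
  then show "generate_field W.L (insert (W.res U) k) \<subseteq> carrier W.L"
    by (rule W.L.generate_field_incl)
  have in_gen: "W.res (subst_fun U p) \<in> generate_field W.L (insert (W.res U) k)" if "poly_over V p" for p
  proof -
    have "W.L.simple_extension k (W.res U) \<subseteq> generate_field W.L (insert (W.res U) k)"
      by (rule W.L.simple_extension_subring_incl
          [OF subfieldE(1)[OF W.L.generate_field_is_subfield[OF sub]]])
        (auto intro: generate_field.incl)
    then show ?thesis using that simple_extension_eq by blast
  qed
  show "carrier W.L \<subseteq> generate_field W.L (insert (W.res U) k)"
  proof
    fix x assume "x \<in> carrier W.L"
    then obtain \<phi> where "\<phi> \<in> W" "x = W.res \<phi>" by (auto simp: W.carrier_L)
    moreover from this obtain p q where pq: "poly_over V p" "poly_over V q" "\<not> poly_over M q"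
      "\<phi> = subst_fun U p / subst_fun U q" using representation by blast
    ultimately have "x = W.res (subst_fun U p) \<otimes>\<^bsub>W.L\<^esub> inv\<^bsub>W.L\<^esub> W.res (subst_fun U q)"
      by (simp add: W.res_divide subst_closed subst_in_N_iff)
    moreover have "W.res (subst_fun U q) \<noteq> \<zero>\<^bsub>W.L\<^esub>"
      using pq by (simp add: W.res_eq_zero_iff subst_closed subst_in_N_iff)
    ultimately show "x \<in> generate_field W.L (insert (W.res U) k)"
      using pq in_gen by (auto intro: generate_field.eng_mult generate_field.m_inv)
  qed
qed

text \<open>Lifts a coefficient list, leading entry first, to a polynomial over \<open>V\<close>.
  The vanishing of the high coefficients carries the induction; the clause on \<open>hd\<close> is
  what transcendence needs.\<close>

lemma eval_eq_res_subst:
  "set xs \<subseteq> k \<Longrightarrow> \<exists>p. poly_over V p \<and> (\<forall>i\<ge>length xs. coeff p i = 0) \<and>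
    W.L.eval xs (W.res U) = W.res (subst_fun U p) \<and>
    (xs \<noteq> [] \<longrightarrow> hd xs = W.res (const_fun (coeff p (length xs - 1))))"
proof (induction xs)
  case Nil
  show ?case by (intro exI[of _ 0]) (simp add: W.res_zero)
next
  case (Cons x xs)
  then obtain p where p: "poly_over V p" "\<forall>i\<ge>length xs. coeff p i = 0"
    "W.L.eval xs (W.res U) = W.res (subst_fun U p)" by auto
  obtain a where a: "a \<in> V" "x = W.res (const_fun a)" using Cons.prems by (auto simp: k_def)
  \<comment> \<open>\<open>p\<close> has no term of degree \<open>length xs\<close>, so the
    coefficient of the sum there is exactly \<open>a\<close>.\<close>
  let ?q = "smult a (monom 1 (length xs)) + p"
  have "W.L.eval (x # xs) (W.res U) = W.res (subst_fun U ?q)"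
    using a p const_closed subst_closed U_closed
    by (simp add: W.res_add W.res_mult W.res_power)
  then show ?case using a p by (intro exI[of _ ?q]) auto
qed

text \<open>A relation lifts to p over \<open>V\<close> with p(U) in \<open>N\<close>, so all
  coefficients of p lie in \<open>M\<close>; but the one lifting the nonzero leading entry does
  not.\<close>

lemma transcendental_res_U: "ring.transcendental W.L k (W.res U)"
proof -
  have "xs = []" if xs: "xs \<in> carrier (univ_poly W.L k)" "W.L.eval xs (W.res U) = \<zero>\<^bsub>W.L\<^esub>" for xs
  proof (rule ccontr)
    assume ne: "xs \<noteq> []"
    have "polynomial\<^bsub>W.L\<^esub> k xs" using xs(1) by (simp add: univ_poly_def)
    then have "set xs \<subseteq> k" "hd xs \<noteq> \<zero>\<^bsub>W.L\<^esub>" using ne by (auto simp: polynomial_def)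
    moreover from this obtain p where p: "poly_over V p"
      "W.L.eval xs (W.res U) = W.res (subst_fun U p)" "hd xs = W.res (const_fun (coeff p (length xs - 1)))"
      using eval_eq_res_subst[of xs] ne by auto
    ultimately have "coeff p (length xs - 1) \<notin> M"
      using const_closed const_in_N_iff by (auto simp: W.res_eq_zero_iff poly_over_def)
    moreover have "poly_over M p"
      using p xs(2) W.res_eq_zero_iff[OF subst_closed[OF p(1)]] subst_in_N_iff by simp
    ultimately show False by (auto simp: poly_over_def)
  qed
  then have "a_kernel (univ_poly W.L k) W.L (\<lambda>p. W.L.eval p (W.res U)) = {[]}"
    by (auto simp: a_kernel_def' univ_poly_def)
  then show ?thesis
    using W.L.trivial_ker_imp_transcendental[OF subring_k] U_closed by (simp add: over_def)
qed

text \<open>The localization of V[U] at the prime ideal generated by \<open>M\<close> and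
  \<open>U\<close>.\<close>

definition local_fractions :: "'a poly fract set"
  where "local_fractions =
    {subst_fun U p / subst_fun U q | p q. poly_over V p \<and> poly_over V q \<and> coeff q 0 \<notin> M}"

text \<open>The ring generator \<tau> is kept apart from \<open>U\<close>, since k[t] is to be
  localized at t - \<theta>(z) as well. The key point is that the ideal generated by the residue of
  \<open>U\<close> consists of the residues of polynomials with constant coefficient in
  \<open>M\<close>.\<close>

lemma poly_local_eq:
  assumes ext: "ring.simple_extension W.L k \<tau> = {W.res (subst_fun U p) | p. poly_over V p}"
  shows "poly_local W.L k \<tau> (W.res U) = W.res ` local_fractions"
proof -
  let ?A = "{W.res (subst_fun U p) | p. poly_over V p}"
  let ?P = "PIdl\<^bsub>W.L\<lparr>carrier := ?A\<rparr>\<^esub> (W.res U)"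
  have mem: "W.res (subst_fun U q) \<in> ?P \<longleftrightarrow> coeff q 0 \<in> M" if q: "poly_over V q" for q
  proof
    assume "W.res (subst_fun U q) \<in> ?P"
    then obtain p where p: "poly_over V p" "W.res (subst_fun U q) = W.res (subst_fun U p) \<otimes>\<^bsub>W.L\<^esub> W.res U"
      by (auto simp: cgenideal_def)
    then have "W.res (subst_fun U q) = W.res (subst_fun U (pCons 0 p))"
      using subst_closed U_closed by (simp add: W.res_mult W.L.m_comm)
    then have "subst_fun U q - subst_fun U (pCons 0 p) \<in> N"
      using p q W.res_eq_iff[OF subst_closed subst_closed, of q "pCons 0 p"] by (simp del: subst_fun_pCons)
    then have "poly_over M (q - pCons 0 p)"
      using p q subst_in_N_iff[of "q - pCons 0 p"] by (simp del: subst_fun_pCons)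
    then show "coeff q 0 \<in> M" by (metis coeff_diff coeff_pCons_0 diff_zero poly_over_def)
  next
    assume m: "coeff q 0 \<in> M"
    obtain a p where ap: "q = pCons a p" by (cases q)
    then have "W.res (subst_fun U q) = W.res (subst_fun U p) \<otimes>\<^bsub>W.L\<^esub> W.res U \<oplus>\<^bsub>W.L\<^esub> \<zero>\<^bsub>W.L\<^esub>"
      using m q const_closed const_in_N_iff W.res_eq_zero_iff[of "const_fun a"]
      by (simp add: res_subst_pCons del: subst_fun_pCons)
    then show "W.res (subst_fun U q) \<in> ?P"
      using q ap subst_closed U_closed by (auto simp: cgenideal_def)
  qed
  \<comment> \<open>A constant coefficient outside \<open>M\<close> makes the denominator a unit of
    \<open>W\<close>, so taking residues commutes with the quotient.\<close>
  have res: "W.res (subst_fun U p / subst_fun U q) = W.res (subst_fun U p) \<otimes>\<^bsub>W.L\<^esub> inv\<^bsub>W.L\<^esub> W.res (subst_fun U q)"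
    if "poly_over V p" "poly_over V q" "coeff q 0 \<notin> M" for p q
    using that W.res_divide subst_closed subst_in_N_iff by (metis poly_over_def)
  have "poly_local W.L k \<tau> (W.res U) = {a \<otimes>\<^bsub>W.L\<^esub> inv\<^bsub>W.L\<^esub> b | a b. a \<in> ?A \<and> b \<in> ?A - ?P}"
    by (simp add: poly_local_def localize_at_def ext)
  also have "\<dots> = {W.res (subst_fun U p) \<otimes>\<^bsub>W.L\<^esub> inv\<^bsub>W.L\<^esub> W.res (subst_fun U q) | p q.
      poly_over V p \<and> poly_over V q \<and> coeff q 0 \<notin> M}"
  proof (intro equalityI subsetI; clarify)
    fix p q
    assume "poly_over V p" "poly_over V q" "W.res (subst_fun U q) \<notin> ?P"
    then show "\<exists>p' q'. W.res (subst_fun U p) \<otimes>\<^bsub>W.L\<^esub> inv\<^bsub>W.L\<^esub> W.res (subst_fun U q) =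
        W.res (subst_fun U p') \<otimes>\<^bsub>W.L\<^esub> inv\<^bsub>W.L\<^esub> W.res (subst_fun U q') \<and>
        poly_over V p' \<and> poly_over V q' \<and> coeff q' 0 \<notin> M"
      using mem by blast
  next
    fix p q
    assume "poly_over V p" "poly_over V q" "coeff q 0 \<notin> M"
    then show "\<exists>a b. W.res (subst_fun U p) \<otimes>\<^bsub>W.L\<^esub> inv\<^bsub>W.L\<^esub> W.res (subst_fun U q) =
        a \<otimes>\<^bsub>W.L\<^esub> inv\<^bsub>W.L\<^esub> b \<and> a \<in> ?A \<and> b \<in> ?A - ?P"
      using mem by blast
  qed
  also have "\<dots> = W.res ` local_fractions"
    unfolding local_fractions_def
  proof (intro equalityI subsetI; clarify)
    fix p q assume "poly_over V p" "poly_over V q" "coeff q 0 \<notin> M"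
    then show "W.res (subst_fun U p) \<otimes>\<^bsub>W.L\<^esub> inv\<^bsub>W.L\<^esub> W.res (subst_fun U q)
      \<in> W.res ` {subst_fun U p / subst_fun U q | p q. poly_over V p \<and> poly_over V q \<and> coeff q 0 \<notin> M}"
      using res[of p q] by (intro image_eqI[where x = "subst_fun U p / subst_fun U q"]) auto
  qed (use res in blast)
  finally show ?thesis .
qed

lemma local_fractions_closed: "local_fractions \<subseteq> W"
proof
  fix \<phi> assume "\<phi> \<in> local_fractions"
  then obtain p q where "poly_over V p" "poly_over V q" "coeff q 0 \<notin> M" "\<phi> = subst_fun U p / subst_fun U q"
    by (auto simp: local_fractions_def)
  then show "\<phi> \<in> W" by (auto intro!: W.divide_closed subst_closed simp: subst_in_N_iff poly_over_def)
qed

text \<open>Translation by y is invertible over \<open>V\<close>: composing with X + y and with X -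
  y passes between polynomials in the two parameters.\<close>

lemma simple_extension_translate:
  assumes U': "gauss_parameter V M W N (U + const_fun y)" and y: "y \<in> V"
  shows "ring.simple_extension W.L k (W.res (U + const_fun y)) = {W.res (subst_fun U p) | p. poly_over V p}"
proof -
  interpret U': gauss_parameter V M W N "U + const_fun y" by fact
  have 1: "subst_fun (U + const_fun y) p = subst_fun U (pcompose p [:y, 1:])" for p
    by (simp add: subst_fun_pcompose const_fun_1 add.commute)
  have 2: "subst_fun U p = subst_fun (U + const_fun y) (pcompose p [:- y, 1:])" for p
    by (simp add: subst_fun_pcompose const_fun_1 const_fun_uminus)
  have "poly_over V (pcompose p [:y, 1:])" "poly_over V (pcompose p [:- y, 1:])" if "poly_over V p" for p
    using that y by (simp_all add: V.poly_over_pcompose)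
  then show ?thesis
    unfolding U'.simple_extension_eq[unfolded U'.k_def, folded k_def] using 1 2 by metis
qed

end

section \<open>Sequences of small values\<close>

text \<open>The values v(r) are positive and eventually drop below each given positive element of
  the value group. The divergent sequences and, after inversion, the convergent one have this
  form.\<close>

locale small_parameter = gauss_parameter V M W N U
  for V M :: "'a::field set" and W N :: "'a poly fract set" and U :: "'a poly fract" +
  fixes G :: "'i filter" and s r :: "'i \<Rightarrow> 'a"
  assumes G_nontrivial: "G \<noteq> bot"
    and value_U: "eventually (\<lambda>\<nu>. ratfun_value U (s \<nu>) (r \<nu>)) G"
    and r_in_M: "eventually (\<lambda>\<nu>. r \<nu> \<in> M \<and> r \<nu> \<noteq> 0) G"
    and r_small: "m \<in> M \<Longrightarrow> m \<noteq> 0 \<Longrightarrow> eventually (\<lambda>\<nu>. m / r \<nu> \<in> M) G"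
begin

lemma power_small: "m \<in> M \<Longrightarrow> eventually (\<lambda>\<nu>. m / r \<nu> ^ n \<in> M) G"
proof (induction n arbitrary: m)
  case (Suc n)
  show ?case
  proof (cases "m = 0")
    case False
    then have "eventually (\<lambda>\<nu>. m / r \<nu> \<in> M \<and> r \<nu> \<in> M \<and> r \<nu> \<noteq> 0) G"
      using r_small[OF Suc.prems] r_in_M by (auto elim: eventually_elim2)
    \<comment> \<open>One late index is frozen, making m / r(\<mu>) and r(\<mu>) fixed elements of
      \<open>M\<close>. Then m / r^(n+1) is the product of (m / r(\<mu>)) / r^n and r(\<mu>) / r,
      treated by the induction hypothesis and by \<open>r_small\<close>.\<close>
    then obtain \<mu> where \<mu>: "m / r \<mu> \<in> M" "r \<mu> \<in> M" "r \<mu> \<noteq> 0"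
      using eventually_happens'[OF G_nontrivial] by blast
    show ?thesis
      using Suc.IH[OF \<mu>(1)] r_small[OF \<mu>(2,3)]
    proof eventually_elim
      case (elim \<nu>)
      then have "m / r \<mu> / r \<nu> ^ n * (r \<mu> / r \<nu>) \<in> M" using V.I_mult V.I_subset by blast
      then show ?case using \<mu> by (simp add: mult.commute)
    qed
  qed simp
qed simp

lemma poly_small: "poly_over M p \<Longrightarrow> eventually (\<lambda>\<nu>. poly p (r \<nu>) / r \<nu> ^ n \<in> M) G"
proof (induction p)
  case (pCons a p)
  then have "a \<in> M" "eventually (\<lambda>\<nu>. poly p (r \<nu>) / r \<nu> ^ n \<in> M) G" by auto
  from power_small[OF this(1), of n] this(2) r_in_M show ?case
  proof eventually_elim
    case (elim \<nu>)
    then have "a / r \<nu> ^ n + r \<nu> * (poly p (r \<nu>) / r \<nu> ^ n) \<in> M"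
      by (intro V.I_add V.I_mult) (auto intro: V.I_subset)
    then show ?case by (simp add: add_divide_distrib)
  qed
qed simp

text \<open>In p(r) / r^d = p1(r) + p0(r) / r^d the first summand is a unit and the second lies in
  \<open>M\<close>; thus p(r) has value exactly d v(r).\<close>

lemma poly_order:
  assumes "p = monom 1 d * p1 + p0" "poly_over V p1" "coeff p1 0 \<notin> M" "poly_over M p0"
  shows "eventually (\<lambda>\<nu>. poly p (r \<nu>) / r \<nu> ^ d \<in> V - M) G"
  using poly_small[OF assms(4), of d] r_in_M
proof eventually_elim
  case (elim \<nu>)
  have eq: "poly p (r \<nu>) / r \<nu> ^ d = poly p1 (r \<nu>) + poly p0 (r \<nu>) / r \<nu> ^ d"
    using elim by (simp add: assms(1) poly_monom add_divide_distrib)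
  have "poly p1 (r \<nu>) \<in> V" "poly p1 (r \<nu>) \<notin> M"
    using elim assms V.poly_in_A V.poly_notin_I V.I_subset by blast+
  then show ?case
    using elim V.I_subset V.I_diff[of "poly p (r \<nu>) / r \<nu> ^ d" "poly p0 (r \<nu>) / r \<nu> ^ d"]
    unfolding eq by auto
qed

lemma value_subst: "eventually (\<lambda>\<nu>. ratfun_value (subst_fun U p) (s \<nu>) (poly p (r \<nu>))) G"
  using value_U by eventually_elim (rule ratfun_value_subst_fun)

lemma value_divide:
  assumes "eventually (\<lambda>\<nu>. poly q (r \<nu>) \<noteq> 0 \<and> poly p (r \<nu>) / poly q (r \<nu>) \<in> V) G"
  shows "subst_fun U p / subst_fun U q \<in> filter_domain V G s"
proof (rule V.filter_domainI)
  show "eventually (\<lambda>\<nu>. ratfun_value (subst_fun U p / subst_fun U q) (s \<nu>) (poly p (r \<nu>) / poly q (r \<nu>))) G"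
    using value_subst[of p] value_subst[of q] assms by eventually_elim (rule ratfun_value_divide, auto)
  show "eventually (\<lambda>\<nu>. poly p (r \<nu>) / poly q (r \<nu>) \<in> V) G"
    using assms by eventually_elim simp
qed

lemma local_fractions_in_domain: "local_fractions \<subseteq> filter_domain V G s"
proof
  fix \<phi> assume "\<phi> \<in> local_fractions"
  then obtain p q where pq: "poly_over V p" "poly_over V q" "coeff q 0 \<notin> M" "\<phi> = subst_fun U p / subst_fun U q"
    by (auto simp: local_fractions_def)
  have "eventually (\<lambda>\<nu>. poly q (r \<nu>) \<noteq> 0 \<and> poly p (r \<nu>) / poly q (r \<nu>) \<in> V) G"
    using r_in_M
  proof eventually_elim
    case (elim \<nu>)
    then have "poly q (r \<nu>) \<notin> M" "poly q (r \<nu>) \<in> V" "poly p (r \<nu>) \<in> V"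
      using pq V.poly_in_A V.poly_notin_I V.I_subset by blast+
    then show ?case using V.divide_closed V.I_zero by metis
  qed
  then show "\<phi> \<in> filter_domain V G s" using value_divide pq by simp
qed

text \<open>The numerator has coefficients in \<open>M\<close>, so its values are divisible by every
  power of r, while those of the denominator are units times a fixed power r^e.\<close>

lemma N_in_domain: "N \<subseteq> filter_domain V G s"
proof
  fix \<phi> assume \<phi>: "\<phi> \<in> N"
  then obtain p q where pq: "poly_over V p" "poly_over V q" "\<not> poly_over M q" "\<phi> = subst_fun U p / subst_fun U q"
    using representation W.I_subset by blast
  have "subst_fun U p \<in> N"
    using W.I_mult[OF \<phi> subst_closed[OF pq(2)]] pq subst_nonzero[OF pq(2,3)] by simp
  then have p: "poly_over M p" using pq subst_in_N_iff by simp
  obtain e q1 q0 where "q = monom 1 e * q1 + q0" "poly_over V q1" "coeff q1 0 \<notin> M" "poly_over M q0"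
    using V.poly_lowest_term[OF pq(2,3)] by blast
  note q = poly_order[OF this]
  have "eventually (\<lambda>\<nu>. poly q (r \<nu>) \<noteq> 0 \<and> poly p (r \<nu>) / poly q (r \<nu>) \<in> V) G"
    using q poly_small[OF p, of e] r_in_M
  proof eventually_elim
    case (elim \<nu>)
    then have "(poly p (r \<nu>) / r \<nu> ^ e) / (poly q (r \<nu>) / r \<nu> ^ e) \<in> V"
      using V.divide_closed V.I_subset by blast
    moreover have "poly q (r \<nu>) \<noteq> 0" using elim by auto
    ultimately show ?case using elim by simp
  qed
  then show "\<phi> \<in> filter_domain V G s" using value_divide pq by simp
qed

text \<open>Compares orders in r: integral values force the denominator to have nonzero reduction,
  of order e at most the order d of the numerator. Cancelling U^e modulo \<open>N\<close> leaves a
  denominator of order 0.\<close>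

lemma domain_residue:
  assumes \<phi>: "\<phi> \<in> filter_domain V G s"
  shows "\<phi> \<in> W \<and> W.res \<phi> \<in> W.res ` local_fractions"
proof -
  obtain p q where pq: "poly_over V p" "poly_over V q" "\<not> (poly_over M p \<and> poly_over M q)"
    "subst_fun U q \<noteq> 0" "\<phi> = subst_fun U p / subst_fun U q"
    using V.primitive_representation[OF generates] .
  obtain b where b: "eventually (\<lambda>\<nu>. ratfun_value \<phi> (s \<nu>) (b \<nu>)) G" "eventually (\<lambda>\<nu>. b \<nu> \<in> V) G"
    using V.filter_domainE[OF \<phi>] .
  have cross: "eventually (\<lambda>\<nu>. b \<nu> * poly q (r \<nu>) = poly p (r \<nu>)) G"
    using b(1) value_subst[of p] value_subst[of q]
  proof eventually_elim
    case (elim \<nu>)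
    have "ratfun_value (\<phi> * subst_fun U q) (s \<nu>) (b \<nu> * poly q (r \<nu>))"
      using elim ratfun_value_mult by blast
    then show ?case using elim pq ratfun_value_unique by simp
  qed
  have lowest: "\<exists>d p1 p0. p = monom 1 d * p1 + p0 \<and> poly_over V p1 \<and> coeff p1 0 \<notin> M \<and> poly_over M p0"
    if "\<not> poly_over M p" using V.poly_lowest_term[OF pq(1) that] .
  \<comment> \<open>Otherwise p has nonzero reduction, and p(r) = b q(r), divided by r^d, would be a
    unit and lie in \<open>M\<close>.\<close>
  have q: "\<not> poly_over M q"
  proof
    assume qM: "poly_over M q"
    then obtain d p1 p0 where "p = monom 1 d * p1 + p0" "poly_over V p1" "coeff p1 0 \<notin> M" "poly_over M p0"
      using lowest pq(3) by blast
    note p = poly_order[OF this]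
    have "eventually (\<lambda>\<nu>. False) G"
      using p poly_small[OF qM, of d] cross b(2)
    proof eventually_elim
      case (elim \<nu>)
      then have "b \<nu> * (poly q (r \<nu>) / r \<nu> ^ d) \<in> M" using V.I_mult' by blast
      then show ?case using elim by simp
    qed
    then show False using G_nontrivial by simp
  qed
  then have qN: "subst_fun U q \<in> W" "subst_fun U q \<notin> N" using pq subst_closed subst_in_N_iff by auto
  then have \<phi>W: "\<phi> \<in> W" using pq subst_closed W.divide_closed by simp
  have "W.res \<phi> \<in> W.res ` local_fractions"
  proof (cases "poly_over M p")
    case True
    then have "\<phi> \<in> N" using pq qN subst_in_N_iff W.divide_in_I by simp
    then have "W.res \<phi> = W.res 0" using \<phi>W by (simp add: W.res_zero W.res_eq_zero_iff)
    moreover have "subst_fun U 0 / subst_fun U 1 \<in> local_fractions"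
      unfolding local_fractions_def mem_Collect_eq
      using V.one_notin_I by (intro exI[of _ 0] exI[of _ 1]) simp
    then have "0 \<in> local_fractions" by simp
    ultimately show ?thesis by (metis imageI)
  next
    case False
    then obtain d p1 p0 where p: "p = monom 1 d * p1 + p0" "poly_over V p1" "coeff p1 0 \<notin> M" "poly_over M p0"
      using lowest by blast
    obtain e q1 q0 where q': "q = monom 1 e * q1 + q0" "poly_over V q1" "coeff q1 0 \<notin> M" "poly_over M q0"
      using V.poly_lowest_term[OF pq(2) q] by blast
    \<comment> \<open>For e > d the unit p(r) / r^d would equal b (q(r) / r^e) r^(e-d), which lies
      in \<open>M\<close>.\<close>
    have "e \<le> d"
    proof (rule ccontr)
      assume "\<not> e \<le> d"
      then have less: "0 < e - d" "e = (e - d) + d" by auto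
      have "eventually (\<lambda>\<nu>. False) G"
        using poly_order[OF p] poly_order[OF q'] cross b(2) r_in_M
      proof eventually_elim
        case (elim \<nu>)
        then have "b \<nu> * (poly q (r \<nu>) / r \<nu> ^ e) * r \<nu> ^ (e - d) \<in> M"
          using V.I_mult' V.I_power less(1) by blast
        moreover have "r \<nu> ^ e = r \<nu> ^ (e - d) * r \<nu> ^ d" using less(2) by (metis power_add)
        ultimately show ?case using elim by simp
      qed
      then show False using G_nontrivial by simp
    qed
    \<comment> \<open>This is U^d p1 / (U^e q1) with U^e cancelled; dropping the parts
      \<open>p0\<close> and \<open>q0\<close> changes \<phi> only by an element of
      \<open>N\<close>.\<close>
    define \<psi> where "\<psi> = subst_fun U (monom 1 (d - e) * p1) / subst_fun U q1"
    have \<psi>: "\<psi> \<in> local_fractions"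
      unfolding \<psi>_def local_fractions_def mem_Collect_eq using p q'
      by (intro exI[of _ "monom 1 (d - e) * p1"] exI[of _ q1]) simp
    then have \<psi>W: "\<psi> \<in> W" using local_fractions_closed by blast
    have q10: "subst_fun U q1 \<noteq> 0" using q' by (intro subst_nonzero) (auto simp: poly_over_def)
    have "subst_fun U (monom 1 d * p1) = \<psi> * subst_fun U (monom 1 e * q1)"
    proof -
      have "U ^ d = U ^ (d - e) * U ^ e" using \<open>e \<le> d\<close> by (simp flip: power_add)
      then show ?thesis using q10 by (simp add: \<psi>_def)
    qed
    also have "subst_fun U (monom 1 e * q1) = subst_fun U q - subst_fun U q0" by (simp add: q'(1))
    finally have "subst_fun U p = \<psi> * (subst_fun U q - subst_fun U q0) + subst_fun U p0"
      by (simp add: p(1))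
    then have "\<phi> - \<psi> = subst_fun U p0 / subst_fun U q - \<psi> * (subst_fun U q0 / subst_fun U q)"
      using pq by (simp add: field_simps)
    moreover have "subst_fun U p0 / subst_fun U q - \<psi> * (subst_fun U q0 / subst_fun U q) \<in> N"
      using p q' qN \<psi>W V.poly_over_I
      by (intro W.I_diff W.I_mult' W.divide_in_I) (simp_all add: subst_in_N_iff)
    ultimately have "W.res \<phi> = W.res \<psi>" using \<phi>W \<psi>W W.res_eq_iff by simp
    then show ?thesis using \<psi> by blast
  qed
  then show ?thesis using \<phi>W by simp
qed

text \<open>The domain contains \<open>N\<close>, hence is the full preimage of its image in the
  residue field.\<close>

lemma filter_domain_eq:
  "filter_domain V G s = {\<phi> \<in> W. W.res \<phi> \<in> W.res ` local_fractions}"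
proof (intro equalityI subsetI)
  fix \<phi> assume "\<phi> \<in> {\<phi> \<in> W. W.res \<phi> \<in> W.res ` local_fractions}"
  then obtain \<psi> where "\<phi> \<in> W" "\<psi> \<in> local_fractions" "W.res \<phi> = W.res \<psi>" by auto
  then have "\<psi> \<in> filter_domain V G s" "\<phi> - \<psi> \<in> filter_domain V G s"
    using local_fractions_closed local_fractions_in_domain N_in_domain W.res_eq_iff by blast+
  then show "\<phi> \<in> filter_domain V G s" using V.filter_domain_add by fastforce
qed (use domain_residue in blast)

lemma res_filter_domain: "W.res ` filter_domain V G s = W.res ` local_fractions"
  using local_fractions_in_domain unfolding filter_domain_eq by blast

end

section \<open>Pseudo-limits\<close>

lemma generates_affine:
  assumes "c \<noteq> 0" shows "generates ((var_X - const_fun z) / const_fun c)"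
  unfolding generates_def
proof
  fix \<phi> :: "'a poly fract"
  let ?T = "(var_X - const_fun z) / const_fun c"
  obtain p q where pq: "\<phi> = Fract p q" "q \<noteq> 0" by (cases \<phi>) auto
  \<comment> \<open>As X = z + c T, composing with \<open>[:z, c:]\<close> rewrites a polynomial in
    X as one in T.\<close>
  have "subst_fun ?T [:z, c:] = var_X" using assms by simp
  then have eq: "subst_fun ?T (pcompose f [:z, c:]) = to_fract f" for f
    by (simp only: subst_fun_pcompose subst_fun_var_X)
  then show "\<exists>p q. subst_fun ?T q \<noteq> 0 \<and> \<phi> = subst_fun ?T p / subst_fun ?T q"
    using pq by (intro exI[of _ "pcompose p [:z, c:]"] exI[of _ "pcompose q [:z, c:]"])
      (simp add: Fract_conv_to_fract)
qed

lemma generates_inverse: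
  assumes U: "generates U" "U \<noteq> 0" shows "generates (inverse U)"
  unfolding generates_def
proof
  fix \<phi>
  have clear: "\<exists>f' n. subst_fun (inverse U) f' = inverse U ^ n * subst_fun U f" for f
  proof (induction f)
    case 0
    show ?case by (intro exI[of _ 0]) simp
  next
    case (pCons a f)
    then obtain f' n where "subst_fun (inverse U) f' = inverse U ^ n * subst_fun U f" by blast
    then have "subst_fun (inverse U) (smult a (monom 1 (Suc n)) + f') = inverse U ^ Suc n * subst_fun U (pCons a f)"
      using U(2) by (simp add: algebra_simps)
    then show ?case by blast
  qed
  obtain p q where pq: "subst_fun U q \<noteq> 0" "\<phi> = subst_fun U p / subst_fun U q"
    using U(1) unfolding generates_def by blast
  obtain p' m where p': "subst_fun (inverse U) p' = inverse U ^ m * subst_fun U p" using clear by blast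
  obtain q' n where q': "subst_fun (inverse U) q' = inverse U ^ n * subst_fun U q" using clear by blast
  \<comment> \<open>The clearing exponents \<open>m\<close> and \<open>n\<close> of numerator and
    denominator may differ; multiplying each by the power of the other gives a common
    factor.\<close>
  define w where "w = inverse U ^ (m + n)"
  have "w \<noteq> 0" using U(2) by (simp add: w_def)
  moreover have "subst_fun (inverse U) (monom 1 n * p') = w * subst_fun U p"
    "subst_fun (inverse U) (monom 1 m * q') = w * subst_fun U q"
    using p' q' by (simp_all add: w_def power_add mult_ac)
  ultimately show "\<exists>p q. subst_fun (inverse U) q \<noteq> 0 \<and>
      \<phi> = subst_fun (inverse U) p / subst_fun (inverse U) q"
    using pq by (intro exI[of _ "monom 1 n * p'"] exI[of _ "monom 1 m * q'"]) (simp del: subst_fun_mult)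
qed

section \<open>Gauges and their uniqueness\<close>

lemma index_set_chain:
  assumes "index_set \<Lambda>"
  obtains \<nu> \<rho> \<sigma> where "\<nu> \<in> \<Lambda>" "\<rho> \<in> \<Lambda>" "\<sigma> \<in> \<Lambda>" "\<nu> < \<rho>" "\<rho> < \<sigma>"
  using assms unfolding index_set_def by (metis all_not_in_conv)

lemma index_set_above:
  assumes "index_set \<Lambda>" "\<mu> \<in> \<Lambda>" "\<nu> \<in> \<Lambda>"
  obtains \<rho> where "\<rho> \<in> \<Lambda>" "\<mu> < \<rho>" "\<nu> < \<rho>"
proof -
  have "max \<mu> \<nu> \<in> \<Lambda>" using assms by (simp add: max_def)
  then obtain \<rho> where "\<rho> \<in> \<Lambda>" "max \<mu> \<nu> < \<rho>" using assms(1) unfolding index_set_def by blast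
  then show ?thesis using that by simp
qed

text \<open>Three increasing indices already separate the types. This reduces the disjunction in
  \<open>is_gauge\<close> to a single clause once the type is known.\<close>

lemma pseudo_monotone_exclusive:
  "pseudo_convergent V \<Lambda> s \<Longrightarrow> \<not> pseudo_divergent V \<Lambda> s"
  "pseudo_convergent V \<Lambda> s \<Longrightarrow> \<not> pseudo_stationary V \<Lambda> s"
  "pseudo_divergent V \<Lambda> s \<Longrightarrow> \<not> pseudo_stationary V \<Lambda> s"
proof -
  have *: "\<not> (pseudo_convergent V \<Lambda> s \<and> pseudo_divergent V \<Lambda> s) \<and>
    \<not> (pseudo_convergent V \<Lambda> s \<and> pseudo_stationary V \<Lambda> s) \<and>
    \<not> (pseudo_divergent V \<Lambda> s \<and> pseudo_stationary V \<Lambda> s)" if ix: "index_set \<Lambda>"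
  proof -
    obtain \<nu> \<rho> \<sigma> where i: "\<nu> \<in> \<Lambda>" "\<rho> \<in> \<Lambda>" "\<sigma> \<in> \<Lambda>" "\<nu> < \<rho>" "\<rho> < \<sigma>"
      using index_set_chain[OF ix] .
    have 1: "val V (s \<rho> - s \<nu>) \<prec> val V (s \<sigma> - s \<rho>)" if "pseudo_convergent V \<Lambda> s"
      using that i unfolding pseudo_convergent_def by blast
    have 2: "val V (s \<sigma> - s \<rho>) \<prec> val V (s \<rho> - s \<nu>)" if "pseudo_divergent V \<Lambda> s"
      using that i unfolding pseudo_divergent_def by blast
    have 3: "val V (s \<sigma> - s \<rho>) = val V (s \<rho> - s \<nu>)" if "pseudo_stationary V \<Lambda> s"
      using that i unfolding pseudo_stationary_def by (metis less_irrefl)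
    show ?thesis using 1 2 3 by (auto simp: val_less_def)
  qed
  then show "pseudo_convergent V \<Lambda> s \<Longrightarrow> \<not> pseudo_divergent V \<Lambda> s"
    "pseudo_convergent V \<Lambda> s \<Longrightarrow> \<not> pseudo_stationary V \<Lambda> s"
    "pseudo_divergent V \<Lambda> s \<Longrightarrow> \<not> pseudo_stationary V \<Lambda> s"
    by (auto simp: pseudo_convergent_def pseudo_divergent_def)
qed

text \<open>Makes the choice of gauge in \<open>pseudo_limits\<close> immaterial. Agreement is only
  eventual, as the gauge of a divergent sequence is arbitrary at the minimum of the index
  set.\<close>

lemma gauge_eventually_unique:
  assumes "is_gauge V \<Lambda> s \<delta>" "is_gauge V \<Lambda> s \<delta>'"
  shows "eventually (\<lambda>\<nu>. \<delta> \<nu> = \<delta>' \<nu>) (tail \<Lambda>)"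
proof -
  have ix: "index_set \<Lambda>"
    using assms(1) by (auto simp: is_gauge_def pseudo_convergent_def pseudo_divergent_def pseudo_stationary_def)
  \<comment> \<open>\<open>\<mu>'\<close> is not the minimum, as the divergent case requires; the
    pair also provides the two distinct indices for the stationary case.\<close>
  obtain \<mu> \<mu>' where mu: "\<mu> \<in> \<Lambda>" "\<mu>' \<in> \<Lambda>" "\<mu> < \<mu>'" using index_set_chain[OF ix] by metis
  consider "pseudo_convergent V \<Lambda> s" | "pseudo_divergent V \<Lambda> s" | "pseudo_stationary V \<Lambda> s"
    using assms(1) by (auto simp: is_gauge_def)
  then have "\<forall>\<nu>\<in>\<Lambda>. \<mu>' \<le> \<nu> \<longrightarrow> \<delta> \<nu> = \<delta>' \<nu>"
  proof cases
    case 1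
    have *: "\<forall>\<nu>\<in>\<Lambda>. \<forall>\<rho>\<in>\<Lambda>. \<nu> < \<rho> \<longrightarrow> g \<nu> = val V (s \<rho> - s \<nu>)" if "is_gauge V \<Lambda> s g" for g
      using that pseudo_monotone_exclusive(1,2)[OF 1] unfolding is_gauge_def by blast
    show ?thesis
    proof (intro ballI impI)
      fix \<nu> assume "\<nu> \<in> \<Lambda>"
      moreover from this obtain \<rho> where "\<rho> \<in> \<Lambda>" "\<nu> < \<rho>" using ix by (auto simp: index_set_def)
      ultimately show "\<delta> \<nu> = \<delta>' \<nu>" using *[OF assms(1)] *[OF assms(2)] by simp
    qed
  next
    case 2
    have *: "\<forall>\<nu>\<in>\<Lambda>. \<forall>\<rho>\<in>\<Lambda>. \<rho> < \<nu> \<longrightarrow> g \<nu> = val V (s \<rho> - s \<nu>)" if "is_gauge V \<Lambda> s g" for g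
      using that pseudo_monotone_exclusive(1)[of V \<Lambda> s] pseudo_monotone_exclusive(3)[OF 2] 2
      unfolding is_gauge_def by blast
    show ?thesis
    proof (intro ballI impI)
      fix \<nu> assume "\<nu> \<in> \<Lambda>" "\<mu>' \<le> \<nu>"
      then show "\<delta> \<nu> = \<delta>' \<nu>" using *[OF assms(1)] *[OF assms(2)] mu by simp
    qed
  next
    case 3
    have *: "\<forall>\<nu>\<in>\<Lambda>. \<forall>\<rho>\<in>\<Lambda>. \<forall>\<mu>\<in>\<Lambda>. \<rho> \<noteq> \<mu> \<longrightarrow> g \<nu> = val V (s \<rho> - s \<mu>)" if "is_gauge V \<Lambda> s g" for g
      using that pseudo_monotone_exclusive(2,3)[of V \<Lambda> s] 3 unfolding is_gauge_def by blast
    show ?thesis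
    proof (intro ballI impI)
      fix \<nu> assume "\<nu> \<in> \<Lambda>"
      then show "\<delta> \<nu> = \<delta>' \<nu>" using *[OF assms(1)] *[OF assms(2)] mu by (metis less_irrefl)
    qed
  qed
  then show ?thesis using mu ix by (auto simp: eventually_tail_iff)
qed

lemma pseudo_limits_index_set: "x \<in> pseudo_limits V \<Lambda> s \<Longrightarrow> index_set \<Lambda>"
  by (auto simp: pseudo_limits_def is_gauge_def pseudo_convergent_def pseudo_divergent_def pseudo_stationary_def)

lemma pseudo_limits_iff_gauge:
  assumes "is_gauge V \<Lambda> s \<delta>" "index_set \<Lambda>"
  shows "x \<in> pseudo_limits V \<Lambda> s \<longleftrightarrow> eventually (\<lambda>\<nu>. val V (x - s \<nu>) = \<delta> \<nu>) (tail \<Lambda>)"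
proof
  assume "x \<in> pseudo_limits V \<Lambda> s"
  then obtain \<delta>' where d: "is_gauge V \<Lambda> s \<delta>'" "eventually (\<lambda>\<nu>. val V (x - s \<nu>) = \<delta>' \<nu>) (tail \<Lambda>)"
    using assms(2) by (auto simp: pseudo_limits_def for_large_iff_eventually)
  from d(2) gauge_eventually_unique[OF d(1) assms(1)]
  show "eventually (\<lambda>\<nu>. val V (x - s \<nu>) = \<delta> \<nu>) (tail \<Lambda>)" by eventually_elim simp
qed (use assms in \<open>auto simp: pseudo_limits_def for_large_iff_eventually\<close>)

text \<open>A known pseudo-limit z supplies the gauge v(z - s), so a further candidate is tested by
  comparing distances.\<close>

lemma pseudo_limits_iff:
  assumes "z \<in> pseudo_limits V \<Lambda> s"
  shows "x \<in> pseudo_limits V \<Lambda> s \<longleftrightarrow>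
    eventually (\<lambda>\<nu>. val V (x - s \<nu>) = val V (z - s \<nu>)) (tail \<Lambda>)"
proof -
  have ix: "index_set \<Lambda>" using pseudo_limits_index_set[OF assms] .
  obtain \<delta> where d: "is_gauge V \<Lambda> s \<delta>" "eventually (\<lambda>\<nu>. val V (z - s \<nu>) = \<delta> \<nu>) (tail \<Lambda>)"
    using assms ix by (auto simp: pseudo_limits_def for_large_iff_eventually)
  have "eventually (\<lambda>\<nu>. val V (x - s \<nu>) = \<delta> \<nu> \<longleftrightarrow> val V (x - s \<nu>) = val V (z - s \<nu>)) (tail \<Lambda>)"
    using d(2) by eventually_elim simp
  then show ?thesis
    unfolding pseudo_limits_iff_gauge[OF d(1) ix] by (rule eventually_cong) simp
qed

section \<open>Distances to the terms of sequences with prescribed pseudo-limits\<close>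

context valuation_max
begin

lemma val_uminus [simp]: "val A (- x) = val A x"
  unfolding val_eq_iff using one_notin_I I_uminus[of "-1"] by auto

lemma val_minus_commute: "val A (x - y) = val A (y - x)"
  using val_uminus[of "x - y"] by simp

lemma val_diff_dominated: "val A x \<prec> val A y \<Longrightarrow> val A (y - x) = val A x"
  unfolding val_less_iff
proof -
  assume *: "x \<noteq> 0 \<and> y / x \<in> I"
  then have "(y - x) / x = y / x - 1" by (simp add: field_simps)
  moreover have "y / x - 1 \<in> A" "y / x - 1 \<notin> I"
    using * I_subset I_diff[of "y / x" "y / x - 1"] one_notin_I by auto
  ultimately have "val A x = val A (y - x)" using * by (simp add: val_eq_iff)
  then show ?thesis by simp
qed

lemma inverse_of_notin_I: "x / y \<notin> I \<Longrightarrow> y / x \<in> A"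
  using I_iff[of "x / y"] by simp

text \<open>The distances v(s - \<alpha>) increase. They stay below v(c): otherwise a term would lie
  in \<alpha> + cV and be a pseudo-limit, though its distances to later terms are constant. They
  exceed each v(c / m), because \<alpha> + c / m is not a pseudo-limit.\<close>

lemma pseudo_convergent_limits:
  assumes s: "pseudo_convergent A \<Lambda> s"
    and lim: "pseudo_limits A \<Lambda> s = (\<lambda>w. \<alpha> + c * w) ` A" and c: "c \<noteq> 0"
  shows "eventually (\<lambda>\<nu>. s \<nu> \<noteq> \<alpha> \<and> c / (s \<nu> - \<alpha>) \<in> I) (tail \<Lambda>)"
    and "m \<in> I \<Longrightarrow> m \<noteq> 0 \<Longrightarrow> eventually (\<lambda>\<nu>. m / (c / (s \<nu> - \<alpha>)) \<in> I) (tail \<Lambda>)"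
proof -
  define d where "d \<nu> = s \<nu> - \<alpha>" for \<nu>
  have ix: "index_set \<Lambda>" using s by (simp add: pseudo_convergent_def)
  have \<alpha>: "\<alpha> \<in> pseudo_limits A \<Lambda> s" unfolding lim by (auto intro: image_eqI[where x = 0])
  obtain \<delta> where \<delta>: "is_gauge A \<Lambda> s \<delta>" using \<alpha> by (auto simp: pseudo_limits_def)
  have gauge: "\<delta> \<nu> = val A (s \<rho> - s \<nu>)" if "\<nu> \<in> \<Lambda>" "\<rho> \<in> \<Lambda>" "\<nu> < \<rho>" for \<nu> \<rho>
    using \<delta> that pseudo_monotone_exclusive(1,2)[OF s] unfolding is_gauge_def by blast
  obtain N where N: "N \<in> \<Lambda>" and val_d: "\<And>\<nu>. \<nu> \<in> \<Lambda> \<Longrightarrow> N \<le> \<nu> \<Longrightarrow> val A (d \<nu>) = \<delta> \<nu>"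
    using \<alpha> ix unfolding pseudo_limits_iff_gauge[OF \<delta> ix] d_def
    by (auto simp: eventually_tail_iff val_minus_commute)
  have incr: "d \<nu> \<noteq> 0 \<and> d \<rho> / d \<nu> \<in> I" if i: "\<nu> \<in> \<Lambda>" "\<rho> \<in> \<Lambda>" "N \<le> \<nu>" "\<nu> < \<rho>" for \<nu> \<rho>
  proof -
    obtain \<sigma> where \<sigma>: "\<sigma> \<in> \<Lambda>" "\<rho> < \<sigma>" using ix i by (auto simp: index_set_def)
    then have "val A (s \<rho> - s \<nu>) \<prec> val A (s \<sigma> - s \<rho>)"
      using s i unfolding pseudo_convergent_def by blast
    then have "val A (d \<nu>) \<prec> val A (d \<rho>)"
      using i \<sigma> gauge[of \<nu> \<rho>] gauge[of \<rho> \<sigma>] val_d by simp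
    then show ?thesis by (simp add: val_less_iff)
  qed
  have lim_iff: "x \<in> pseudo_limits A \<Lambda> s \<longleftrightarrow>
      (\<exists>N'\<in>\<Lambda>. \<forall>\<nu>\<in>\<Lambda>. N' \<le> \<nu> \<longrightarrow> val A (x - s \<nu>) = val A (d \<nu>))" for x
    unfolding pseudo_limits_iff[OF \<alpha>] d_def
    by (simp add: eventually_tail_iff[OF ix] val_minus_commute[of \<alpha>])
  have "d \<nu> \<noteq> 0 \<and> c / d \<nu> \<in> I" if i: "\<nu> \<in> \<Lambda>" "N \<le> \<nu>" for \<nu>
  proof -
    obtain \<rho>' where "\<rho>' \<in> \<Lambda>" "\<nu> < \<rho>'" using ix i by (auto simp: index_set_def)
    then have d0: "d \<nu> \<noteq> 0" using incr i by blast
    have "c / d \<nu> \<in> I"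
    proof (rule ccontr)
      assume "c / d \<nu> \<notin> I"
      then have "d \<nu> / c \<in> A" by (rule inverse_of_notin_I)
      moreover have "s \<nu> = \<alpha> + c * (d \<nu> / c)" using c by (simp add: d_def)
      ultimately have "s \<nu> \<in> pseudo_limits A \<Lambda> s" unfolding lim by blast
      then obtain N' where N': "N' \<in> \<Lambda>" "\<And>\<rho>. \<rho> \<in> \<Lambda> \<Longrightarrow> N' \<le> \<rho> \<Longrightarrow> val A (s \<nu> - s \<rho>) = val A (d \<rho>)"
        unfolding lim_iff by blast
      obtain \<rho> where \<rho>: "\<rho> \<in> \<Lambda>" "\<nu> < \<rho>" "N' < \<rho>" using index_set_above[OF ix i(1) N'(1)] .
      then have "val A (d \<nu>) = val A (d \<rho>)"
        using N'(2)[of \<rho>] gauge[of \<nu> \<rho>] val_d[of \<nu>] i by (simp add: val_minus_commute)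
      moreover have "val A (d \<nu>) \<prec> val A (d \<rho>)" using incr[of \<nu> \<rho>] i \<rho> by (simp add: val_less_iff)
      ultimately show False by (simp add: val_less_def)
    qed
    then show ?thesis using d0 by simp
  qed
  then show "eventually (\<lambda>\<nu>. s \<nu> \<noteq> \<alpha> \<and> c / (s \<nu> - \<alpha>) \<in> I) (tail \<Lambda>)"
    using N ix by (auto simp: eventually_tail_iff d_def)
  assume m: "m \<in> I" "m \<noteq> 0"
  have "\<alpha> + c / m \<notin> pseudo_limits A \<Lambda> s"
  proof
    assume "\<alpha> + c / m \<in> pseudo_limits A \<Lambda> s"
    then obtain w where "w \<in> A" "c / m = c * w" unfolding lim by auto
    then have "inverse m \<in> A" using c by (simp add: divide_inverse)
    then show False using m I_nonunit by blast
  qed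
  then obtain \<nu> where \<nu>: "\<nu> \<in> \<Lambda>" "N \<le> \<nu>" "val A (\<alpha> + c / m - s \<nu>) \<noteq> val A (d \<nu>)"
    unfolding lim_iff using N by blast
  have "\<alpha> + c / m - s \<nu> = c / m - d \<nu>" by (simp add: d_def)
  \<comment> \<open>If \<open>d \<nu>\<close> had smaller value than c / m, the difference would
    have the value of \<open>d \<nu>\<close>, against the choice of \<nu>.\<close>
  then have "\<not> val A (d \<nu>) \<prec> val A (c / m)" using \<nu> val_diff_dominated by metis
  moreover have "d \<nu> \<noteq> 0" using incr \<nu> ix by (metis index_set_def)
  ultimately have md: "d \<nu> / (c / m) \<in> A"
    using inverse_of_notin_I[of "c / m" "d \<nu>"] by (simp only: val_less_iff simp_thms)
  have "m / (c / d \<rho>) \<in> I" if "\<rho> \<in> \<Lambda>" "\<nu> < \<rho>" for \<rho>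
  proof -
    have "d \<nu> / (c / m) * (d \<rho> / d \<nu>) \<in> I" using md incr \<nu> that I_mult' by blast
    then show ?thesis using incr[of \<nu> \<rho>] \<nu> that by (simp add: mult.commute)
  qed
  moreover obtain \<nu>' where "\<nu>' \<in> \<Lambda>" "\<nu> < \<nu>'" using ix \<nu> by (auto simp: index_set_def)
  ultimately show "eventually (\<lambda>\<nu>. m / (c / (s \<nu> - \<alpha>)) \<in> I) (tail \<Lambda>)"
    using ix unfolding eventually_tail_iff[OF ix] d_def by (metis less_le_trans)
qed

text \<open>The distances v(s - z) decrease. They stay above v(c): otherwise z + c would be a
  pseudo-limit, although c is not in cM. They drop below each v(c m), because z + c m is a
  pseudo-limit.\<close>

lemma pseudo_divergent_limits:
  assumes s: "pseudo_divergent A \<Lambda> s"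
    and lim: "pseudo_limits A \<Lambda> s = (\<lambda>w. z + c * w) ` I" and c: "c \<noteq> 0"
  shows "eventually (\<lambda>\<nu>. s \<nu> \<noteq> z \<and> (s \<nu> - z) / c \<in> I) (tail \<Lambda>)"
    and "m \<in> I \<Longrightarrow> m \<noteq> 0 \<Longrightarrow> eventually (\<lambda>\<nu>. m / ((s \<nu> - z) / c) \<in> I) (tail \<Lambda>)"
proof -
  define d where "d \<nu> = s \<nu> - z" for \<nu>
  have ix: "index_set \<Lambda>" using s by (simp add: pseudo_divergent_def)
  have z: "z \<in> pseudo_limits A \<Lambda> s" unfolding lim by (auto intro: image_eqI[where x = 0])
  obtain \<delta> where \<delta>: "is_gauge A \<Lambda> s \<delta>" using z by (auto simp: pseudo_limits_def)
  have gauge: "\<delta> \<nu> = val A (s \<rho> - s \<nu>)" if "\<nu> \<in> \<Lambda>" "\<rho> \<in> \<Lambda>" "\<rho> < \<nu>" for \<nu> \<rho>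
    using \<delta> that pseudo_monotone_exclusive(1)[of A \<Lambda> s] pseudo_monotone_exclusive(3)[OF s] s
    unfolding is_gauge_def by blast
  obtain N where N: "N \<in> \<Lambda>" and val_d: "\<And>\<nu>. \<nu> \<in> \<Lambda> \<Longrightarrow> N \<le> \<nu> \<Longrightarrow> val A (d \<nu>) = \<delta> \<nu>"
    using z ix unfolding pseudo_limits_iff_gauge[OF \<delta> ix] d_def
    by (auto simp: eventually_tail_iff val_minus_commute)
  have decr: "d \<rho> \<noteq> 0 \<and> d \<nu> / d \<rho> \<in> I" if i: "\<nu> \<in> \<Lambda>" "\<rho> \<in> \<Lambda>" "N < \<nu>" "\<nu> < \<rho>" for \<nu> \<rho>
  proof -
    have "val A (s \<rho> - s \<nu>) \<prec> val A (s \<nu> - s N)"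
      using s i N unfolding pseudo_divergent_def by blast
    then have "val A (d \<rho>) \<prec> val A (d \<nu>)"
      using i N gauge[of \<rho> \<nu>] gauge[of \<nu> N] val_d by (simp add: val_minus_commute)
    then show ?thesis by (simp add: val_less_iff)
  qed
  have lim_iff: "x \<in> pseudo_limits A \<Lambda> s \<longleftrightarrow>
      (\<exists>N'\<in>\<Lambda>. \<forall>\<nu>\<in>\<Lambda>. N' \<le> \<nu> \<longrightarrow> val A (x - s \<nu>) = val A (d \<nu>))" for x
    unfolding pseudo_limits_iff[OF z] d_def
    by (simp add: eventually_tail_iff[OF ix] val_minus_commute[of z])
  \<comment> \<open>\<open>decr\<close> needs indices beyond \<open>N\<close> and gives nonvanishing
    only at the later one, so the claim starts two steps after \<open>N\<close>.\<close>
  obtain N1 N2 where N12: "N1 \<in> \<Lambda>" "N < N1" "N2 \<in> \<Lambda>" "N1 < N2"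
    using ix N unfolding index_set_def by metis
  have "d \<nu> \<noteq> 0 \<and> d \<nu> / c \<in> I" if i: "\<nu> \<in> \<Lambda>" "N2 \<le> \<nu>" for \<nu>
  proof
    show d0: "d \<nu> \<noteq> 0" using decr[of N1 \<nu>] N12 i by simp
    show "d \<nu> / c \<in> I"
    proof (rule ccontr)
      assume "d \<nu> / c \<notin> I"
      then have cd: "c / d \<nu> \<in> A" by (rule inverse_of_notin_I)
      have eq: "val A (z + c - s \<rho>) = val A (d \<rho>)" if \<rho>: "\<rho> \<in> \<Lambda>" "\<nu> < \<rho>" for \<rho>
      proof -
        have *: "d \<rho> \<noteq> 0 \<and> d \<nu> / d \<rho> \<in> I" using decr[of \<nu> \<rho>] N12 i \<rho> by simp
        then have "c / d \<nu> * (d \<nu> / d \<rho>) \<in> I" using cd I_mult' by blast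
        then have "val A (d \<rho>) \<prec> val A c" using * d0 by (simp add: val_less_iff)
        then have "val A (c - d \<rho>) = val A (d \<rho>)" by (rule val_diff_dominated)
        moreover have "z + c - s \<rho> = c - d \<rho>" by (simp add: d_def)
        ultimately show ?thesis by (simp only:)
      qed
      obtain \<nu>' where "\<nu>' \<in> \<Lambda>" "\<nu> < \<nu>'" using ix i by (auto simp: index_set_def)
      then have "z + c \<in> pseudo_limits A \<Lambda> s" unfolding lim_iff using eq by (metis less_le_trans)
      then obtain w where "w \<in> I" "c = c * w" unfolding lim by auto
      then show False using c one_notin_I by simp
    qed
  qed
  then show "eventually (\<lambda>\<nu>. s \<nu> \<noteq> z \<and> (s \<nu> - z) / c \<in> I) (tail \<Lambda>)"
    using N12 ix by (auto simp: eventually_tail_iff d_def)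
  assume m: "m \<in> I" "m \<noteq> 0"
  then have "z + c * m \<in> pseudo_limits A \<Lambda> s" unfolding lim by blast
  then obtain N' where N': "N' \<in> \<Lambda>" "\<And>\<nu>. \<nu> \<in> \<Lambda> \<Longrightarrow> N' \<le> \<nu> \<Longrightarrow> val A (z + c * m - s \<nu>) = val A (d \<nu>)"
    unfolding lim_iff by blast
  obtain \<mu> where \<mu>: "\<mu> \<in> \<Lambda>" "N1 < \<mu>" "N' < \<mu>" using index_set_above[OF ix N12(1) N'(1)] .
  have "m / (d \<nu> / c) \<in> I" if \<nu>: "\<nu> \<in> \<Lambda>" "\<mu> < \<nu>" for \<nu>
  proof (rule ccontr)
    assume "m / (d \<nu> / c) \<notin> I"
    then have "d \<nu> / c / m \<in> A" by (rule inverse_of_notin_I)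
    moreover have *: "d \<nu> \<noteq> 0 \<and> d \<mu> / d \<nu> \<in> I" using decr[of \<mu> \<nu>] N12 \<mu> \<nu> by simp
    ultimately have "d \<nu> / c / m * (d \<mu> / d \<nu>) \<in> I" using I_mult' by blast
    \<comment> \<open>Now c m has smaller value than \<open>d \<mu>\<close>, so their difference has
      the value of c m, whereas the pseudo-limit z + c m requires that of
      \<open>d \<mu>\<close>.\<close>
    then have less: "val A (c * m) \<prec> val A (d \<mu>)" using * m c by (simp add: val_less_iff)
    then have "val A (d \<mu> - c * m) = val A (c * m)" by (rule val_diff_dominated)
    moreover have "z + c * m - s \<mu> = c * m - d \<mu>" by (simp add: d_def)
    ultimately have "val A (d \<mu>) = val A (c * m)"
      using N'(2)[OF \<mu>(1)] \<mu>(3) val_minus_commute[of "c * m" "d \<mu>"] by (simp only: less_imp_le)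
    then show False using less by (simp add: val_less_def)
  qed
  moreover obtain \<nu>' where "\<nu>' \<in> \<Lambda>" "\<mu> < \<nu>'" using ix \<mu> by (auto simp: index_set_def)
  ultimately show "eventually (\<lambda>\<nu>. m / ((s \<nu> - z) / c) \<in> I) (tail \<Lambda>)"
    using ix unfolding eventually_tail_iff[OF ix] d_def by (metis less_le_trans)
qed

text \<open>The constant gauge is v(c). A term \<open>s \<mu>\<close> is itself a pseudo-limit, so c
  divides d = \<alpha> - s(\<mu>); for late \<mu> also d and d + c have equal value, \<alpha> and
  \<alpha> + c being pseudo-limits, so d divides c.\<close>

lemma pseudo_stationary_limits:
  assumes s: "pseudo_stationary A \<Lambda> s"
    and lim: "pseudo_limits A \<Lambda> s = (\<lambda>w. \<alpha> + c * w) ` A" and c: "c \<noteq> 0"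
    and x: "x \<in> (\<lambda>w. \<alpha> + c * w) ` A"
  shows "eventually (\<lambda>\<nu>. (s \<nu> - x) / c \<in> A - I) (tail \<Lambda>)"
proof -
  have ix: "index_set \<Lambda>" using s by (simp add: pseudo_stationary_def)
  have \<alpha>: "\<alpha> \<in> pseudo_limits A \<Lambda> s" unfolding lim by (auto intro: image_eqI[where x = 0])
  have \<alpha>c: "\<alpha> + c \<in> pseudo_limits A \<Lambda> s" unfolding lim by (auto intro: image_eqI[where x = 1])
  obtain \<delta> where \<delta>: "is_gauge A \<Lambda> s \<delta>" using \<alpha> by (auto simp: pseudo_limits_def)
  have gauge: "\<delta> \<nu> = val A (s \<rho> - s \<mu>)" if "\<nu> \<in> \<Lambda>" "\<rho> \<in> \<Lambda>" "\<mu> \<in> \<Lambda>" "\<rho> \<noteq> \<mu>" for \<nu> \<rho> \<mu>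
    using \<delta> that pseudo_monotone_exclusive(2,3)[of A \<Lambda> s] s unfolding is_gauge_def by blast
  have lim_iff: "y \<in> pseudo_limits A \<Lambda> s \<longleftrightarrow>
      (\<exists>N\<in>\<Lambda>. \<forall>\<nu>\<in>\<Lambda>. N \<le> \<nu> \<longrightarrow> val A (y - s \<nu>) = \<delta> \<nu>)" for y
    unfolding pseudo_limits_iff_gauge[OF \<delta> ix] eventually_tail_iff[OF ix] ..
  obtain N N' where N: "N \<in> \<Lambda>" "\<And>\<nu>. \<nu> \<in> \<Lambda> \<Longrightarrow> N \<le> \<nu> \<Longrightarrow> val A (\<alpha> - s \<nu>) = \<delta> \<nu>"
    and N': "N' \<in> \<Lambda>" "\<And>\<nu>. \<nu> \<in> \<Lambda> \<Longrightarrow> N' \<le> \<nu> \<Longrightarrow> val A (\<alpha> + c - s \<nu>) = \<delta> \<nu>"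
    using \<alpha> \<alpha>c unfolding lim_iff by blast
  obtain \<mu> where \<mu>: "\<mu> \<in> \<Lambda>" "N < \<mu>" "N' < \<mu>" using index_set_above[OF ix N(1) N'(1)] .
  define d where "d = \<alpha> - s \<mu>"
  have val_d: "val A d = \<delta> \<mu>" "val A (d + c) = \<delta> \<mu>"
    using N(2)[of \<mu>] N'(2)[of \<mu>] \<mu> by (simp_all add: d_def algebra_simps)
  have "s \<mu> \<in> pseudo_limits A \<Lambda> s"
  proof -
    obtain \<mu>' where "\<mu>' \<in> \<Lambda>" "\<mu> < \<mu>'" using ix \<mu> by (auto simp: index_set_def)
    then show ?thesis unfolding lim_iff using gauge \<mu> by (metis leD)
  qed
  then obtain w where w: "w \<in> A" "d = - (c * w)" unfolding lim d_def by auto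
  then have dc: "d / c \<in> A" using c by simp
  have d0: "d \<noteq> 0"
  proof
    assume "d = 0"
    then have "val A 0 = val A c" using val_d by simp
    then show False using c by (simp add: val_eq_iff)
  qed
  then have "(d + c) / d \<in> A" using val_d by (metis DiffD1 val_eq_iff)
  then have "(d + c) / d - 1 \<in> A" by blast
  then have "c / d \<in> A" using d0 by (simp add: field_simps)
  then have "d / c \<notin> I" using I_nonunit[of "d / c"] d0 c by auto
  then have "val A c = val A d" using dc c by (simp add: val_eq_iff)
  then have val_c: "val A c = \<delta> \<mu>" using val_d(1) by simp
  have \<delta>_const: "\<delta> \<nu> = \<delta> \<mu>" if "\<nu> \<in> \<Lambda>" for \<nu>
    using gauge[of \<nu> N \<mu>] gauge[of \<mu> N \<mu>] that N(1) \<mu> by simp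
  obtain N'' where N'': "N'' \<in> \<Lambda>" "\<And>\<nu>. \<nu> \<in> \<Lambda> \<Longrightarrow> N'' \<le> \<nu> \<Longrightarrow> val A (x - s \<nu>) = \<delta> \<nu>"
    using x unfolding lim[symmetric] lim_iff by blast
  have "(s \<nu> - x) / c \<in> A - I" if "\<nu> \<in> \<Lambda>" "N'' \<le> \<nu>" for \<nu>
  proof -
    have "val A c = val A (s \<nu> - x)"
      using N''(2)[of \<nu>] \<delta>_const[of \<nu>] val_c that by (simp add: val_minus_commute)
    then show ?thesis using c by (auto simp: val_eq_iff)
  qed
  then show ?thesis using N''(1) ix by (auto simp: eventually_tail_iff)
qed

end

section \<open>The parameters (X - z) / c and the three claims\<close>

lemma ratfun_value_affine:
  "c \<noteq> 0 \<Longrightarrow> ratfun_value ((var_X - const_fun z) / const_fun c) a ((a - z) / c)"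
  by (intro ratfun_value_divide ratfun_value_diff ratfun_value_var_X ratfun_value_const)

lemma ratfun_value_inverse_affine:
  assumes "c \<noteq> 0" "a \<noteq> z"
  shows "ratfun_value (inverse ((var_X - const_fun z) / const_fun c)) a (c / (a - z))"
  using ratfun_value_inverse[OF ratfun_value_affine[of c z a]] assms by simp

theorem proposition7p2:
  fixes V M :: "'a::field set"
    and \<alpha> c :: 'a
    and \<Lambda>E :: "'i::wellorder set" and E :: "'i \<Rightarrow> 'a"
    and \<Lambda>F :: "'j::wellorder set" and F :: "'j \<Rightarrow> 'a"
    and \<Lambda>D :: "'a \<Rightarrow> 'l::wellorder set" and D :: "'a \<Rightarrow> 'l \<Rightarrow> 'a"
    and MF :: "'a poly fract set"
  defines "VE \<equiv> seq_domain V \<Lambda>E E"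
    and "VF \<equiv> seq_domain V \<Lambda>F F"
    and "VD \<equiv> (\<lambda>z. seq_domain V (\<Lambda>D z) (D z))"
  defines "\<pi> \<equiv> (\<lambda>\<phi>. MF +>\<^bsub>ring_on VF\<^esub> \<phi>)"
    and "L \<equiv> ring_on VF Quot MF"
  defines "k \<equiv> \<pi> ` const_fun ` V"
    and "t \<equiv> \<pi> ((var_X - const_fun \<alpha>) / const_fun c)"
    and "\<theta> \<equiv> (\<lambda>z. \<pi> (const_fun ((z - \<alpha>) / c)))"
  assumes V: "valuation_domain_of V"
    and M: "maximalideal M (ring_on V)"
    and M_not_fg: "\<not> fg_ideal (ring_on V) M"
    and inf_residue: "infinite (carrier (ring_on V Quot M))"
    and c: "c \<noteq> 0"
    and E: "pseudo_convergent V \<Lambda>E E" "pseudo_limits V \<Lambda>E E = (\<lambda>w. \<alpha> + c * w) ` V"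
    and F: "pseudo_stationary V \<Lambda>F F" "pseudo_limits V \<Lambda>F F = (\<lambda>w. \<alpha> + c * w) ` V"
    and D: "\<And>z. z \<in> (\<lambda>w. \<alpha> + c * w) ` V \<Longrightarrow>
        pseudo_divergent V (\<Lambda>D z) (D z) \<and> pseudo_limits V (\<Lambda>D z) (D z) = (\<lambda>w. z + c * w) ` M"
    and MF: "maximalideal MF (ring_on VF)"
  shows "(carrier L = generate_field L (insert t k) \<and> ring.transcendental L k t) \<and>
    \<pi> ` VE = poly_local L k (inv\<^bsub>L\<^esub> t) (inv\<^bsub>L\<^esub> t) \<and>
    (\<forall>z \<in> (\<lambda>w. \<alpha> + c * w) ` V. \<theta> z \<in> k \<and> \<pi> ` VD z = poly_local L k t (t \<ominus>\<^bsub>L\<^esub> \<theta> z)) \<and>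
    (\<forall>x \<in> k. \<forall>y \<in> V. \<pi> (const_fun y) = x \<longrightarrow>
        {\<phi> \<in> VF. \<pi> \<phi> \<in> poly_local L k t (t \<ominus>\<^bsub>L\<^esub> x)} = VD (\<alpha> + y * c))"
proof -
  interpret V: valuation_max V M using V M by (rule valuation_max.intro)
  define T where "T z = (var_X - const_fun z) / const_fun c" for z
  have ixE: "index_set \<Lambda>E" and ixF: "index_set \<Lambda>F"
    using E(1) F(1) by (simp_all add: pseudo_convergent_def pseudo_stationary_def)
  have VF_eq: "VF = filter_domain V (tail \<Lambda>F) F"
    unfolding VF_def by (rule seq_domain_eq_filter_domain[OF ixF])
  interpret F: transcendental_residue V M "tail \<Lambda>F" F
    by unfold_locales (rule tail_neq_bot[OF ixF])
  note F_unit = V.pseudo_stationary_limits[OF F c]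
  have in_coset: "\<alpha> + c * w \<in> (\<lambda>w. \<alpha> + c * w) ` V" if "w \<in> V" for w using that by blast
  have \<alpha>: "\<alpha> \<in> (\<lambda>w. \<alpha> + c * w) ` V" using in_coset[of 0] by simp
  \<comment> \<open>The element (F - z) / c - x equals (F - (z + c x)) / c, and z + c x is again a
    pseudo-limit of \<open>F\<close>, so \<open>F_unit\<close> applies.\<close>
  have F_avoid: "eventually (\<lambda>\<nu>. (F \<nu> - z) / c - x \<notin> M) (tail \<Lambda>F)"
    if z: "z \<in> (\<lambda>w. \<alpha> + c * w) ` V" and x: "x \<in> V" for z x
  proof -
    obtain w where "w \<in> V" "z = \<alpha> + c * w" using z by blast
    then have "z + c * x \<in> (\<lambda>w. \<alpha> + c * w) ` V"
      using in_coset[of "w + x"] x by (simp add: algebra_simps)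
    from F_unit[OF this] show ?thesis
      by eventually_elim (use c in \<open>simp add: field_simps\<close>)
  qed
  have gp: "gauss_parameter V M VF MF (T z)" if z: "z \<in> (\<lambda>w. \<alpha> + c * w) ` V" for z
    unfolding VF_eq
  proof (rule F.gauss_parameterI)
    show "F.avoids_residues (T z)"
      unfolding F.avoids_residues_def T_def
    proof (intro exI[of _ "\<lambda>\<nu>. (F \<nu> - z) / c"] conjI ballI)
      show "eventually (\<lambda>\<nu>. (F \<nu> - z) / c \<in> V) (tail \<Lambda>F)"
        using F_unit[OF z] by eventually_elim simp
    qed (simp_all add: ratfun_value_affine c F_avoid z)
    show "generates (T z)" unfolding T_def by (rule generates_affine[OF c])
    show "maximalideal MF (ring_on (filter_domain V (tail \<Lambda>F) F))" using MF VF_eq by simp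
  qed
  interpret T: gauss_parameter V M VF MF "T \<alpha>" by (rule gp[OF \<alpha>])
  have \<pi>_eq: "T.W.res = \<pi>" by (simp add: fun_eq_iff T.W.res_def \<pi>_def)
  have k_eq: "T.k = k" by (simp add: T.k_def k_def \<pi>_eq)
  have t_eq: "t = \<pi> (T \<alpha>)" by (simp add: t_def T_def)
  have T_notin: "T \<alpha> \<notin> MF"
    using T.subst_in_N_iff[of "[:0, 1:]"] V.one_notin_I by (simp add: const_fun_1)
  have inv_t: "inv\<^bsub>L\<^esub> t = \<pi> (inverse (T \<alpha>))"
    using T.W.res_inverse[OF T.U_closed T_notin] by (simp add: \<pi>_eq t_eq L_def)
  have gp_inverse: "gauss_parameter V M VF MF (inverse (T \<alpha>))"
    unfolding VF_eq
  proof (rule F.gauss_parameterI)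
    show "F.avoids_residues (inverse (T \<alpha>))"
      unfolding F.avoids_residues_def
    proof (intro exI[of _ "\<lambda>\<nu>. c / (F \<nu> - \<alpha>)"] conjI ballI)
      show "eventually (\<lambda>\<nu>. ratfun_value (inverse (T \<alpha>)) (F \<nu>) (c / (F \<nu> - \<alpha>))) (tail \<Lambda>F)"
        using F_unit[OF \<alpha>]
      proof eventually_elim
        case (elim \<nu>)
        then have "F \<nu> \<noteq> \<alpha>" by auto
        then show ?case unfolding T_def using c by (rule ratfun_value_inverse_affine[rotated])
      qed
      show "eventually (\<lambda>\<nu>. c / (F \<nu> - \<alpha>) \<in> V) (tail \<Lambda>F)"
        using F_unit[OF \<alpha>] by eventually_elim (use V.inverse_of_notin_I in blast)
      fix x assume x: "x \<in> V"
      show "eventually (\<lambda>\<nu>. c / (F \<nu> - \<alpha>) - x \<notin> M) (tail \<Lambda>F)"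
      \<comment> \<open>Here u = (F - \<alpha>) / c is a unit. So 1 / u is not congruent to an x in
        \<open>M\<close>; for a unit x, a congruence of 1 / u with x would make u congruent to 1 /
        x, which \<open>F_avoid\<close> excludes.\<close>
      proof (cases "x \<in> M")
        case True
        show ?thesis using F_unit[OF \<alpha>]
        proof eventually_elim
          case (elim \<nu>)
          define u where "u = (F \<nu> - \<alpha>) / c"
          have "u \<in> V" "u \<notin> M" using elim by (auto simp: u_def)
          then have u: "u \<in> V" "inverse u \<in> V" "u \<noteq> 0"
            using V.inverse_notin_I_closed by auto
          have "inverse u - x \<notin> M"
          proof
            assume "inverse u - x \<in> M"
            then have "inverse u - x + x \<in> M" using True by (rule V.I_add)
            then show False using V.I_nonunit[of "inverse u"] u by simp
          qed
          then show ?case by (simp add: u_def)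
        qed
      next
        case False
        then have inv: "inverse x \<in> V" "x \<noteq> 0" using x V.inverse_notin_I_closed by auto
        show ?thesis using F_avoid[OF \<alpha> inv(1)] F_unit[OF \<alpha>]
        proof eventually_elim
          case (elim \<nu>)
          define u where "u = (F \<nu> - \<alpha>) / c"
          have u: "u \<in> V" "u \<notin> M" "u \<noteq> 0" "u - inverse x \<notin> M"
            using elim by (auto simp: u_def)
          have "inverse u - x \<notin> M"
          proof
            assume "inverse u - x \<in> M"
            then have "- (inverse u - x) * (u * inverse x) \<in> M"
              using u inv by (intro V.I_mult V.I_uminus) auto
            moreover have "- (inverse u - x) * (u * inverse x) = u - inverse x"
              using u inv by (simp add: field_simps)
            ultimately show False using u by simp
          qed
          then show ?case by (simp add: u_def)
        qed
      qed
    qed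
    show "generates (inverse (T \<alpha>))"
      using T_notin by (intro generates_inverse T.generates) auto
    show "maximalideal MF (ring_on (filter_domain V (tail \<Lambda>F) F))" using MF VF_eq by simp
  qed

  have a: "\<pi> ` VE = poly_local L k (inv\<^bsub>L\<^esub> t) (inv\<^bsub>L\<^esub> t)"
  proof -
    interpret U: gauss_parameter V M VF MF "inverse (T \<alpha>)" by (rule gp_inverse)
    have U_k: "U.k = k" by (simp add: U.k_def k_def \<pi>_eq)
    \<comment> \<open>Along \<open>E\<close> the values of (X - \<alpha>) / c lie outside
      \<open>V\<close>; the inverse is the parameter with values in \<open>M\<close>.\<close>
    interpret U: small_parameter V M VF MF "inverse (T \<alpha>)" "tail \<Lambda>E" E "\<lambda>\<nu>. c / (E \<nu> - \<alpha>)"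
    proof unfold_locales
      show "tail \<Lambda>E \<noteq> bot" using tail_neq_bot[OF ixE] .
      note lim = V.pseudo_convergent_limits[OF E c]
      show "eventually (\<lambda>\<nu>. ratfun_value (inverse (T \<alpha>)) (E \<nu>) (c / (E \<nu> - \<alpha>))) (tail \<Lambda>E)"
        using lim(1) by eventually_elim (use c in \<open>simp add: T_def ratfun_value_inverse_affine del: inverse_divide\<close>)
      show "eventually (\<lambda>\<nu>. c / (E \<nu> - \<alpha>) \<in> M \<and> c / (E \<nu> - \<alpha>) \<noteq> 0) (tail \<Lambda>E)"
        using lim(1) by eventually_elim (use c in simp)
      show "eventually (\<lambda>\<nu>. m / (c / (E \<nu> - \<alpha>)) \<in> M) (tail \<Lambda>E)" if "m \<in> M" "m \<noteq> 0" for m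
        using lim(2) that .
    qed
    have "\<pi> ` VE = \<pi> ` U.local_fractions"
      using U.res_filter_domain
      by (simp add: VE_def seq_domain_eq_filter_domain[OF ixE] \<pi>_eq)
    also have "\<dots> = poly_local L k (inv\<^bsub>L\<^esub> t) (inv\<^bsub>L\<^esub> t)"
      using U.poly_local_eq[OF U.simple_extension_eq] by (simp add: U_k \<pi>_eq inv_t flip: L_def)
    finally show ?thesis .
  qed

  \<comment> \<open>The preimage identity \<open>c'\<close> is proved along with (b); claim (c) is
    its instance at z = \<alpha> + y c.\<close>
  have b: "\<pi> ` VD z = poly_local L k t (t \<ominus>\<^bsub>L\<^esub> \<theta> z)"
    and c': "VD z = {\<phi> \<in> VF. \<pi> \<phi> \<in> poly_local L k t (t \<ominus>\<^bsub>L\<^esub> \<theta> z)}"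
    if z: "z \<in> (\<lambda>w. \<alpha> + c * w) ` V" for z
  proof -
    define y where "y = (z - \<alpha>) / c"
    have y: "y \<in> V" using z c by (auto simp: y_def)
    interpret U: gauss_parameter V M VF MF "T z" by (rule gp[OF z])
    have U_k: "U.k = k" by (simp add: U.k_def k_def \<pi>_eq)
    have Dz: "pseudo_divergent V (\<Lambda>D z) (D z)" "pseudo_limits V (\<Lambda>D z) (D z) = (\<lambda>w. z + c * w) ` M"
      using D[OF z] by auto
    have ixD: "index_set (\<Lambda>D z)" using Dz(1) by (simp add: pseudo_divergent_def)
    interpret U: small_parameter V M VF MF "T z" "tail (\<Lambda>D z)" "D z" "\<lambda>\<nu>. (D z \<nu> - z) / c"
    proof unfold_locales
      show "tail (\<Lambda>D z) \<noteq> bot" using tail_neq_bot[OF ixD] .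
      note lim = V.pseudo_divergent_limits[OF Dz c]
      show "eventually (\<lambda>\<nu>. ratfun_value (T z) (D z \<nu>) ((D z \<nu> - z) / c)) (tail (\<Lambda>D z))"
        using c by (simp add: T_def ratfun_value_affine)
      show "eventually (\<lambda>\<nu>. (D z \<nu> - z) / c \<in> M \<and> (D z \<nu> - z) / c \<noteq> 0) (tail (\<Lambda>D z))"
        using lim(1) by eventually_elim (use c in simp)
      show "eventually (\<lambda>\<nu>. m / ((D z \<nu> - z) / c) \<in> M) (tail (\<Lambda>D z))" if "m \<in> M" "m \<noteq> 0" for m
        using lim(2) that .
    qed
    \<comment> \<open>The two parameters differ by the constant y, whose residue is \<theta>(z).
      Hence t - \<theta>(z) is the residue of \<open>T z\<close>, and that residue generates the
      same ring k[t], as \<open>poly_local_eq\<close> requires.\<close>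
    have T_eq: "T \<alpha> = T z + const_fun y"
      using c by (simp add: T_def y_def const_fun_divide const_fun_diff field_simps)
    have "\<pi> (T z) = \<pi> (T \<alpha> - const_fun y)" by (simp add: T_eq)
    also have "\<dots> = t \<ominus>\<^bsub>L\<^esub> \<theta> z"
      using T.W.res_diff[OF T.U_closed T.const_closed[OF y]]
      by (simp add: t_eq \<theta>_def y_def L_def \<pi>_eq)
    finally have w: "t \<ominus>\<^bsub>L\<^esub> \<theta> z = \<pi> (T z)" by simp
    have "gauss_parameter V M VF MF (T z + const_fun y)" using T.gauss_parameter_axioms T_eq by simp
    from U.poly_local_eq[OF U.simple_extension_translate[OF this y]]
    have loc: "poly_local L k t (t \<ominus>\<^bsub>L\<^esub> \<theta> z) = \<pi> ` U.local_fractions"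
      by (simp add: U_k \<pi>_eq w flip: L_def T_eq t_eq)
    have VD: "VD z = filter_domain V (tail (\<Lambda>D z)) (D z)"
      unfolding VD_def by (rule seq_domain_eq_filter_domain[OF ixD])
    show "\<pi> ` VD z = poly_local L k t (t \<ominus>\<^bsub>L\<^esub> \<theta> z)"
      using U.res_filter_domain by (simp add: VD loc \<pi>_eq)
    show "VD z = {\<phi> \<in> VF. \<pi> \<phi> \<in> poly_local L k t (t \<ominus>\<^bsub>L\<^esub> \<theta> z)}"
      using U.filter_domain_eq by (simp add: VD loc \<pi>_eq)
  qed

  have \<theta>: "\<theta> z \<in> k" if "z \<in> (\<lambda>w. \<alpha> + c * w) ` V" for z
    using that c by (auto simp: \<theta>_def k_def)
  have "{\<phi> \<in> VF. \<pi> \<phi> \<in> poly_local L k t (t \<ominus>\<^bsub>L\<^esub> x)} = VD (\<alpha> + y * c)"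
    if y: "y \<in> V" "\<pi> (const_fun y) = x" for x y
  proof -
    have "\<theta> (\<alpha> + y * c) = x" using c y by (simp add: \<theta>_def)
    then show ?thesis using c'[of "\<alpha> + y * c"] in_coset[OF y(1)] by (simp add: mult.commute)
  qed
  then show ?thesis
    using T.generate_field_eq T.transcendental_res_U a b \<theta> by (simp add: \<pi>_eq k_eq t_eq L_def)
qed

end
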